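(* Let $\Delta$ be the Sierpiński triangle, let $0<\alpha\le 1$, and let $f:\Delta\to\mathbb{R}$ be a 1-Hölder-$\alpha$ function, i.e. $|f(a)-f(b)|\le |a-b|^\alpha$ for all $a,b\in\Delta$. Let $h:(0,\tfrac12]\to\mathbb{R}$ be $$h(d)=\frac{-d\log d-(1-d)\log(1-d)+d\log 6}{(1+d)\log 2}.$$ Then for Lebesgue almost every $r\in f(\Delta)$ we have $$\dim_H(f^{-1}(r))\ge \frac{h^{-1}(\alpha)}{1+h^{-1}(\alpha)}.$$ Consequently, $D_*(\alpha,\Delta)\ge \dfrac{h^{-1}(\alpha)}{1+h^{-1}(\alpha)}$.
   Context: The Sierpiński triangle is $\Delta=\bigcap_{n\ge 0}\Delta_n$, where $\Delta_0$ is a closed equilateral triangle of side length $1$ and $\Delta_n$ is the union of the $3^n$ closed triangles of side length $2^{-n}$ of the $n$th step of the standard construction. Here $h$ is strictly increasing on $(0,\frac12]$ with range containing $(0,1]$, and $h^{-1}$ is its inverse. For compact $F\subset\mathbb{R}^p$ and $0<\alpha\le1$, $C_1^\alpha(F)$ is the set of $f:F\to\mathbb{R}$ with $|f(a)-f(b)|\le|a-b|^\alpha$ for all $a,b\in F$, with the topology of the supremum norm. For $f:F\to\mathbb{R}$ put $$D_*^f(F)=\sup\{d:\lambda(\{r:\dim_H(f^{-1}(r))\ge d\})>0\},$$ where $\lambda$ is one-dimensional Lebesgue measure and $\dim_H$ is Hausdorff dimension. Let $\mathfrak{G}_{1,\alpha}(F)$ be the collection of dense $G_\delta$ subsets of $C_1^\alpha(F)$,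 and $$D_*(\alpha,F)=\sup_{\mathcal{G}\in\mathfrak{G}_{1,\alpha}(F)}\ \inf\{D_*^f(F): f\in\mathcal{G}\}.$$ *)

theory Defs
  imports "HOL-Analysis.Analysis"
begin

section \<open>Hausdorff measure and dimension\<close>

text \<open>The \<open>s\<close>-th power of the diameter, with the conventions that the empty set has weight \<open>0\<close>
  and every nonempty set has weight \<open>1\<close> for \<open>s = 0\<close> (note \<open>0 powr 0 = 0\<close>), so that the
  \<open>0\<close>-dimensional measure is the counting measure.\<close>

definition hausdorff_weight :: "real \<Rightarrow> 'a::metric_space set \<Rightarrow> ennreal" where
  "hausdorff_weight s U =
     (if U = {} then 0 else if s = 0 then 1 else ennreal (diameter U powr s))"

text \<open>Boundedness is required explicitly since \<^const>\<open>diameter\<close> is real-valued and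
  carries no information on unbounded sets.\<close>

definition hausdorff_premeasure :: "real \<Rightarrow> real \<Rightarrow> 'a::metric_space set \<Rightarrow> ennreal" where
  "hausdorff_premeasure \<delta> s A =
     (INF U \<in> {U :: nat \<Rightarrow> 'a set. A \<subseteq> (\<Union>i. U i) \<and> (\<forall>i. bounded (U i) \<and> diameter (U i) \<le> \<delta>)}.
        \<Sum>i. hausdorff_weight s (U i))"

definition hausdorff_measure :: "real \<Rightarrow> 'a::metric_space set \<Rightarrow> ennreal" where
  "hausdorff_measure s A = (SUP \<delta> \<in> {0<..}. hausdorff_premeasure \<delta> s A)"

text \<open>With this definition the empty set has dimension \<open>0\<close>.\<close>

definition hausdorff_dim :: "'a::metric_space set \<Rightarrow> ereal" where
  "hausdorff_dim A = Inf {ereal s | s. 0 \<le> s \<and> hausdorff_measure s A = 0}"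


section \<open>The Sierpinski triangle\<close>

text \<open>The union of the \<open>3 ^ n\<close> closed triangles of the \<open>n\<close>-th step, starting from the closed
  triangle with vertices \<open>A\<close>, \<open>B\<close>, \<open>C\<close>.\<close>

primrec sierpinski_stage :: "nat \<Rightarrow> 'a::real_vector \<Rightarrow> 'a \<Rightarrow> 'a \<Rightarrow> 'a set" where
  "sierpinski_stage 0 A B C = convex hull {A, B, C}"
| "sierpinski_stage (Suc n) A B C =
     sierpinski_stage n A (midpoint A B) (midpoint A C) \<union>
     sierpinski_stage n (midpoint A B) B (midpoint B C) \<union>
     sierpinski_stage n (midpoint A C) (midpoint B C) C"

definition sierpinski_triangle :: "'a::real_vector \<Rightarrow> 'a \<Rightarrow> 'a \<Rightarrow> 'a set" where
  "sierpinski_triangle A B C = (\<Inter>n. sierpinski_stage n A B C)"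


section \<open>Generic level sets of 1-Hoelder functions\<close>

definition holder1_on :: "real \<Rightarrow> 'a::metric_space set \<Rightarrow> ('a \<Rightarrow> real) \<Rightarrow> bool" where
  "holder1_on \<alpha> F f \<longleftrightarrow> (\<forall>a\<in>F. \<forall>b\<in>F. \<bar>f a - f b\<bar> \<le> dist a b powr \<alpha>)"

text \<open>Functions with domain \<open>F\<close> are represented by elements of \<^term>\<open>extensional F\<close>; the
  topology of the supremum norm is the one of the library's space of bounded functions.\<close>

definition holder1_space :: "real \<Rightarrow> 'a::metric_space set \<Rightarrow> ('a \<Rightarrow> real) set" where
  "holder1_space \<alpha> F = {f \<in> extensional F. holder1_on \<alpha> F f}"

definition holder1_topology :: "real \<Rightarrow> 'a::metric_space set \<Rightarrow> ('a \<Rightarrow> real) topology" where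
  "holder1_topology \<alpha> F =
     subtopology (mtopology_of (funspace F euclidean_metric)) (holder1_space \<alpha> F)"

lemma topspace_holder1_topology:
  assumes "compact F" "0 \<le> \<alpha>"
  shows "topspace (holder1_topology \<alpha> F) = holder1_space \<alpha> F"
proof -
  have "bounded (f ` F)" if f: "holder1_on \<alpha> F f" for f
  proof (cases "F = {}")
    case False
    then obtain a where a: "a \<in> F" by blast
    obtain D where D: "\<And>x. x \<in> F \<Longrightarrow> dist a x \<le> D"
      using compact_imp_bounded[OF assms(1)] unfolding bounded_any_center[of F a] by blast
    show ?thesis
      unfolding bounded_any_center[of "f ` F" "f a"]
    proof (intro exI[of _ "D powr \<alpha>"] ballI)
      fix y assume "y \<in> f ` F"
      then obtain x where x: "x \<in> F" "y = f x" by blast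
      have "dist (f a) y \<le> dist a x powr \<alpha>"
        using f a x by (auto simp: holder1_on_def dist_real_def)
      also have "\<dots> \<le> D powr \<alpha>"
        using D x assms(2) by (intro powr_mono2) auto
      finally show "dist (f a) y \<le> D powr \<alpha>" .
    qed
  qed simp
  then show ?thesis
    by (auto simp: holder1_topology_def holder1_space_def Met_TC.fspace_def)
qed

text \<open>The collection of dense \<open>G\<^sub>\<delta>\<close> subsets of the Hoelder space.\<close>

definition dense_gdeltas :: "real \<Rightarrow> 'a::metric_space set \<Rightarrow> ('a \<Rightarrow> real) set set" where
  "dense_gdeltas \<alpha> F =
     {G. gdelta_in (holder1_topology \<alpha> F) G \<and>
         holder1_topology \<alpha> F closure_of G = topspace (holder1_topology \<alpha> F)}"

definition level_dim :: "'a::metric_space set \<Rightarrow> ('a \<Rightarrow> real) \<Rightarrow> ereal" where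
  "level_dim F f =
     Sup {ereal d | d. emeasure lebesgue {r. ereal d \<le> hausdorff_dim {x \<in> F. f x = r}} > 0}"

definition generic_level_dim :: "real \<Rightarrow> 'a::metric_space set \<Rightarrow> ereal" where
  "generic_level_dim \<alpha> F = (SUP G \<in> dense_gdeltas \<alpha> F. INF f \<in> G. level_dim F f)"


section \<open>The function \<open>h\<close> and its inverse\<close>

definition h_fun :: "real \<Rightarrow> real" where
  "h_fun d = (- d * ln d - (1 - d) * ln (1 - d) + d * ln 6) / ((1 + d) * ln 2)"

text \<open>Inverse of the restriction of \<^const>\<open>h_fun\<close> to \<open>(0, 1/2]\<close>, where it is strictly increasing.\<close>

definition h_inv :: "real \<Rightarrow> real" where
  "h_inv = the_inv_into {0<..1/2} h_fun"

end

theory Submission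
  imports Defs "HOL-Real_Asymp.Real_Asymp"
begin

text \<open>Fix a level \<open>r\<close> and give each vertex of the construction the sign of \<open>f - r\<close>. The edges lie in the
  gasket, so every triangle whose corners have different signs meets the level set. Following these
  active triangles downwards gives a tree; distributing mass equally among the active children bounds
  the dimension of the level set from below by the proportion of branching steps along the paths.

  A change of letter in the address of an active triangle forces a branching at one of two
  consecutive steps. Hence a path with few branchings has an address made of few blocks of two letters,
  with \<open>6\<close> choices each, and of single letters repeating their predecessor. A triangle of level \<open>n\<close> is
  active only for a set of levels of measure at most a constant times \<open>2 powr (- \<alpha> * n)\<close>. If \<open>\<alpha> = h d\<close>,
  counting the addresses with a proportion of less than \<open>d / (1 + d)\<close> double blocks by a generating
  function and applying the Borel-Cantelli lemma shows that almost every level has no such paths at fine scales.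

  A level that crosses no triangle is the maximum or the minimum of \<open>f\<close>. For the generic statement, the
  functions with different values at two given vertices form a dense open set.\<close>

section \<open>Words and trees of signs\<close>

datatype corner = CA | CB | CC

lemma UNIV_corner: "UNIV = {CA, CB, CC}"
  using corner.exhaust by auto

instance corner :: finite
  by standard (simp add: UNIV_corner)

lemma ex_corner: "(\<exists>i. P i) \<longleftrightarrow> P CA \<or> P CB \<or> P CC"
  by (metis corner.exhaust)

definition words :: "nat \<Rightarrow> corner list set" where
  "words n = {w. length w = n}"

lemma finite_words [simp]: "finite (words n)"
  using finite_lists_length_eq[of "UNIV :: corner set" n] by (simp add: words_def)

lemma words_0 [simp]: "words 0 = {[]}"
  by (auto simp: words_def)

lemma words_Suc: "words (Suc n) = (\<lambda>(w, i). i # w) ` (words n \<times> UNIV)"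
  by (auto simp: words_def image_iff length_Suc_conv)

lemma sum_words_Suc: "(\<Sum>w\<in>words (Suc n). g w) = (\<Sum>w\<in>words n. \<Sum>i\<in>UNIV. g (i # w))"
proof -
  have inj: "inj_on (\<lambda>(w, i). i # w) (words n \<times> (UNIV :: corner set))"
    by (auto simp: inj_on_def)
  show ?thesis
    unfolding words_Suc sum.reindex[OF inj] by (simp add: sum.cartesian_product case_prod_unfold)
qed

text \<open>Words are read from their last letter to their first and cut greedily into blocks: a letter
  equal to its predecessor is a block of length one, any other letter forms a block of length two
  together with its successor. \<open>starts_double w\<close> says that the head of \<open>w\<close> opens such a block of
  length two; the empty word is treated as such an opening, so that the first letter is free.\<close>

primrec starts_double :: "corner list \<Rightarrow> bool" where
  "starts_double [] = True"
| "starts_double (i # w) = (\<not> starts_double w \<and> i \<noteq> hd w)"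

primrec doubles :: "corner list \<Rightarrow> nat" where
  "doubles [] = 0"
| "doubles (i # w) = doubles w + (if starts_double (i # w) then 1 else 0)"

lemma sum_power_doubles:
  fixes x \<rho> :: real
  assumes "\<rho>\<^sup>2 = \<rho> + 6 * x"
  shows "(\<Sum>w\<in>words n. (if starts_double w then 3 else \<rho>) * x ^ doubles w) = 3 * \<rho> ^ n"
proof (induction n)
  case (Suc n)
  have "(\<Sum>i\<in>UNIV. (if starts_double (i # w) then 3 else \<rho>) * x ^ doubles (i # w)) =
      \<rho> * ((if starts_double w then 3 else \<rho>) * x ^ doubles w)" for w
  proof (cases "starts_double w")
    case False
    have "(\<Sum>i\<in>UNIV. (if starts_double (i # w) then 3 else \<rho>) * x ^ doubles (i # w)) =
        (\<rho> + 6 * x) * x ^ doubles w"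
      using False by (cases "hd w") (simp_all add: UNIV_corner algebra_simps)
    then show ?thesis
      using False by (simp flip: assms add: power2_eq_square)
  qed (simp add: UNIV_corner)
  then show ?case
    by (simp add: sum_words_Suc Suc.IH flip: sum_distrib_left)
qed simp

lemma card_few_doubles_le:
  fixes x \<rho> t :: real
  assumes \<rho>: "\<rho>\<^sup>2 = \<rho> + 6 * x" "1 \<le> \<rho>" and x: "0 < x" "x \<le> 1"
  shows "real (card {w \<in> words n. doubles w < t}) \<le> 3 * \<rho> ^ n * x powr (- t)"
proof -
  let ?W = "{w \<in> words n. doubles w < t}"
  have "real (card ?W) * x powr t = (\<Sum>w\<in>?W. x powr t)"
    by simp
  also have "\<dots> \<le> (\<Sum>w\<in>?W. x ^ doubles w)"
    using x by (intro sum_mono) (auto simp flip: powr_realpow intro!: powr_mono')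
  also have "\<dots> \<le> (\<Sum>w\<in>words n. x ^ doubles w)"
    using x by (intro sum_mono2) auto
  also have "\<dots> \<le> (\<Sum>w\<in>words n. (if starts_double w then 3 else \<rho>) * x ^ doubles w)"
  proof (intro sum_mono)
    fix w
    have "1 * x ^ doubles w \<le> (if starts_double w then 3 else \<rho>) * x ^ doubles w"
      using \<rho> x by (intro mult_right_mono) auto
    then show "x ^ doubles w \<le> (if starts_double w then 3 else \<rho>) * x ^ doubles w"
      by simp
  qed
  also have "\<dots> = 3 * \<rho> ^ n"
    by (rule sum_power_doubles[OF \<rho>(1)])
  finally show ?thesis
    using x by (simp add: powr_minus field_simps)
qed

definition mixed :: "(corner \<Rightarrow> bool) \<Rightarrow> bool" where
  "mixed \<sigma> \<longleftrightarrow> (\<exists>j k. \<sigma> j \<and> \<not> \<sigma> k)"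

lemma mixed_iff: "mixed \<sigma> \<longleftrightarrow> \<not> (\<sigma> CA = \<sigma> CB \<and> \<sigma> CA = \<sigma> CC)"
  unfolding mixed_def ex_corner by blast

locale sign_tree =
  fixes sgn_at :: "corner list \<Rightarrow> corner \<Rightarrow> bool"
  assumes same_corner: "sgn_at (i # w) i = sgn_at w i"
    and shared_corner: "sgn_at (i # w) j = sgn_at (j # w) i"
begin

definition kids :: "corner list \<Rightarrow> corner set" where
  "kids w = {i. mixed (sgn_at (i # w))}"

primrec active :: "corner list \<Rightarrow> bool" where
  "active [] = mixed (sgn_at [])"
| "active (i # w) = (active w \<and> i \<in> kids w)"

primrec branchings :: "corner list \<Rightarrow> nat" where
  "branchings [] = 0"
| "branchings (i # w) = branchings w + (if card (kids w) \<ge> 2 then 1 else 0)"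

primrec mass :: "corner list \<Rightarrow> real" where
  "mass [] = 1"
| "mass (i # w) = mass w / card (kids w)"

lemma active_imp_mixed: "active w \<Longrightarrow> mixed (sgn_at w)"
  by (cases w) (auto simp: kids_def)

lemma kids_nonempty:
  assumes "mixed (sgn_at w)"
  shows "kids w \<noteq> {}"
proof -
  have "mixed (sgn_at (CA # w)) \<or> mixed (sgn_at (CB # w)) \<or> mixed (sgn_at (CC # w))"
    using assms same_corner[of CA w] same_corner[of CB w] same_corner[of CC w]
      shared_corner[of CA w CB] shared_corner[of CA w CC] shared_corner[of CB w CC]
    unfolding mixed_iff by (cases "sgn_at w CA"; cases "sgn_at w CB"; cases "sgn_at w CC"; auto)
  then show ?thesis
    unfolding kids_def by blast
qed

lemma only_kid:
  assumes "mixed (sgn_at w)" "\<not> card (kids w) \<ge> 2" "i \<in> kids w"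
  shows "kids w = {i}"
proof -
  have "card (kids w) = 1"
    using assms kids_nonempty[OF assms(1)] card_gt_0_iff[of "kids w"] by auto
  then show ?thesis
    using assms(3) by (metis card_1_singletonE singletonD)
qed

lemma signs_of_only_kid:
  assumes "mixed (sgn_at w)" "kids w = {i}" "j \<noteq> i"
  shows "sgn_at w j \<noteq> sgn_at w i \<and> sgn_at (i # w) j = sgn_at w j"
proof -
  have "mixed (sgn_at (k # w)) \<longleftrightarrow> k = i" for k
    using assms(2) unfolding kids_def by auto
  then have *: "mixed (sgn_at (CA # w)) = (i = CA)" "mixed (sgn_at (CB # w)) = (i = CB)"
     "mixed (sgn_at (CC # w)) = (i = CC)"
    by auto
  show ?thesis
    using assms(1,3) * same_corner[of CA w] same_corner[of CB w] same_corner[of CC w]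
      shared_corner[of CA w CB] shared_corner[of CA w CC] shared_corner[of CB w CC]
    unfolding mixed_iff
    by (cases "sgn_at w CA"; cases "sgn_at w CB"; cases "sgn_at w CC"; cases i; cases j; simp)
qed

text \<open>A triangle with a single active subtriangle passes on its signs and the corner that has a sign
  of its own; so two consecutive steps without branching go to the same corner.\<close>

lemma letter_change_imp_branching:
  assumes "active (j # i # w)" "i \<noteq> j"
  shows "card (kids w) \<ge> 2 \<or> card (kids (i # w)) \<ge> 2"
proof (rule ccontr)
  assume "\<not> ?thesis"
  moreover have m: "mixed (sgn_at w)" "mixed (sgn_at (i # w))"
    using assms by (auto intro: active_imp_mixed simp: kids_def)
  ultimately have k: "kids w = {i}" "kids (i # w) = {j}"
    using assms only_kid[of w i] only_kid[of "i # w" j] by auto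
  obtain l where l: "l \<noteq> i" "l \<noteq> j"
    by (metis corner.distinct corner.exhaust)
  show False
    using signs_of_only_kid[OF m(1) k(1), of j] signs_of_only_kid[OF m(1) k(1), of l]
      signs_of_only_kid[OF m(2) k(2), of i] signs_of_only_kid[OF m(2) k(2), of l]
      l assms(2) same_corner[of i w] by auto
qed

lemma doubles_le_branchings: "active w \<Longrightarrow> doubles w \<le> branchings w"
proof (induction w rule: length_induct)
  case (1 w)
  show ?case
  proof (cases "starts_double w \<and> w \<noteq> []")
    case True
    then obtain j v where w: "w = j # v" "\<not> starts_double v" "j \<noteq> hd v"
      by (cases w) auto
    then obtain i u where v: "v = i # u"
      by (cases v) auto
    have "doubles u \<le> branchings u"
      using 1 w v by auto
    moreover have "card (kids u) \<ge> 2 \<or> card (kids (i # u)) \<ge> 2"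
      using 1 w v by (intro letter_change_imp_branching[of j]) auto
    moreover have "doubles w = doubles u + 1"
      using w v by auto
    ultimately show ?thesis
      using w v by auto
  next
    case False
    then show ?thesis
      using 1 by (cases w) (fastforce simp: trans_le_add1)+
  qed
qed

lemma mass_nonneg: "0 \<le> mass w"
  by (induction w) auto

lemma mass_le: "active w \<Longrightarrow> mass w \<le> (1/2) ^ branchings w"
proof (induction w)
  case (Cons i w)
  have IH: "mass w \<le> (1/2) ^ branchings w"
    using Cons by auto
  have pos: "card (kids w) > 0"
    using Cons.prems by (auto simp: card_gt_0_iff)
  show ?case
  proof (cases "card (kids w) \<ge> 2")
    case True
    have "mass w / card (kids w) \<le> mass w / 2"
      using True mass_nonneg[of w] by (intro divide_left_mono) auto
    then show ?thesis
      using True IH by simp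
  next
    case False
    then have "card (kids w) = 1"
      using pos by linarith
    then show ?thesis
      using IH by simp
  qed
qed simp

lemma sum_mass_kids:
  assumes "active w"
  shows "(\<Sum>i\<in>UNIV. if active (i # w) then mass (i # w) else 0) = mass w"
proof -
  have "(\<Sum>i\<in>UNIV. if active (i # w) then mass (i # w) else 0) = (\<Sum>i\<in>kids w. mass w / card (kids w))"
    using assms by (simp add: sum.If_cases Int_def)
  then show ?thesis
    using kids_nonempty[OF active_imp_mixed[OF assms]] by simp
qed

lemma sum_mass_descendants:
  assumes "active v"
  shows "(\<Sum>u\<in>words n. if active (u @ v) then mass (u @ v) else 0) = mass v"
proof (induction n)
  case (Suc n)
  have "(\<Sum>i\<in>UNIV. if active ((i # u) @ v) then mass ((i # u) @ v) else 0) =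
      (if active (u @ v) then mass (u @ v) else 0)" for u
    using sum_mass_kids[of "u @ v"] by (cases "active (u @ v)") (auto cong: if_cong)
  then show ?case
    by (simp only: sum_words_Suc Suc.IH)
qed (use assms in simp)

lemma sum_mass_cut_ge:
  assumes "active []" "finite S" "\<And>v. v \<in> S \<Longrightarrow> active v \<and> length v \<le> M"
    and cut: "\<And>w. w \<in> words M \<Longrightarrow> active w \<Longrightarrow> \<exists>v\<in>S. \<exists>u. w = u @ v"
  shows "1 \<le> (\<Sum>v\<in>S. mass v)"
proof -
  let ?g = "\<lambda>w. if active w then mass w else 0"
  have "1 = (\<Sum>w\<in>words M. ?g w)"
    using sum_mass_descendants[OF assms(1), of M] by (simp cong: if_cong)
  also have "\<dots> \<le> (\<Sum>w\<in>words M. \<Sum>v\<in>S. if \<exists>u. w = u @ v then ?g w else 0)"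
  proof (intro sum_mono)
    fix w assume w: "w \<in> words M"
    show "?g w \<le> (\<Sum>v\<in>S. if \<exists>u. w = u @ v then ?g w else 0)"
    proof (cases "active w")
      case True
      then obtain v where v: "v \<in> S" "\<exists>u. w = u @ v"
        using cut w by blast
      have "?g w = (if \<exists>u. w = u @ v then ?g w else 0)"
        using v by simp
      also have "\<dots> \<le> (\<Sum>v\<in>S. if \<exists>u. w = u @ v then ?g w else 0)"
        using v(1) assms(2) mass_nonneg
        by (intro member_le_sum[of v S "\<lambda>v. if \<exists>u. w = u @ v then ?g w else 0"]) auto
      finally show ?thesis .
    qed (simp add: sum_nonneg)
  qed
  also have "\<dots> = (\<Sum>v\<in>S. \<Sum>w\<in>words M. if \<exists>u. w = u @ v then ?g w else 0)"
    by (rule sum.swap)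
  also have "\<dots> = (\<Sum>v\<in>S. mass v)"
  proof (intro sum.cong refl)
    fix v assume v: "v \<in> S"
    have "(\<Sum>w\<in>words M. if \<exists>u. w = u @ v then ?g w else 0) =
        (\<Sum>w\<in>(\<lambda>u. u @ v) ` words (M - length v). ?g w)"
      using assms(3)[OF v]
      by (intro sum.mono_neutral_cong_right finite_words) (auto simp: words_def image_iff)
    also have "\<dots> = (\<Sum>u\<in>words (M - length v). ?g (u @ v))"
      by (subst sum.reindex) (auto simp: inj_on_def)
    also have "\<dots> = mass v"
      using assms(3)[OF v] by (intro sum_mass_descendants) auto
    finally show "(\<Sum>w\<in>words M. if \<exists>u. w = u @ v then ?g w else 0) = mass v" .
  qed
  finally show ?thesis .
qed

lemma active_append: "active (u @ v) \<Longrightarrow> active v"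
  by (induction u) auto

end

section \<open>Geometry of the gasket\<close>

definition sub_triangle :: "corner \<Rightarrow> (corner \<Rightarrow> 'a::real_vector) \<Rightarrow> corner \<Rightarrow> 'a" where
  "sub_triangle i V = (\<lambda>j. midpoint (V i) (V j))"

text \<open>The head of a word is the last step, that is, the choice made at the finest level.\<close>

primrec triangle_at :: "(corner \<Rightarrow> 'a::real_vector) \<Rightarrow> corner list \<Rightarrow> corner \<Rightarrow> 'a" where
  "triangle_at V [] = V"
| "triangle_at V (i # w) = sub_triangle i (triangle_at V w)"

lemma triangle_at_append: "triangle_at V (u @ v) = triangle_at (triangle_at V v) u"
  by (induction u) auto

definition stage :: "(corner \<Rightarrow> 'a::real_vector) \<Rightarrow> nat \<Rightarrow> 'a set" where
  "stage V n = (\<Union>w\<in>words n. convex hull (range (triangle_at V w)))"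

definition gasket :: "(corner \<Rightarrow> 'a::real_vector) \<Rightarrow> 'a set" where
  "gasket V = (\<Inter>n. stage V n)"

lemma stage_0: "stage V 0 = convex hull (range V)"
  by (simp add: stage_def)

lemma words_Suc': "words (Suc n) = (\<lambda>(w, i). w @ [i]) ` (words n \<times> UNIV)"
  by (auto simp: words_def image_iff length_Suc_conv_rev)

lemma stage_Suc: "stage V (Suc n) = (\<Union>i. stage (sub_triangle i V) n)"
proof -
  have "stage V (Suc n) = (\<Union>p\<in>words n \<times> UNIV. convex hull (range (triangle_at (sub_triangle (snd p) V) (fst p))))"
    by (simp add: stage_def words_Suc' triangle_at_append case_prod_unfold)
  also have "\<dots> = (\<Union>i. \<Union>w\<in>words n. convex hull (range (triangle_at (sub_triangle i V) w)))"
    by (rule set_eqI) (simp add: Bex_def split_paired_Ex; metis)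
  finally show ?thesis
    by (simp add: stage_def)
qed

lemma sierpinski_stage_eq:
  "sierpinski_stage n (V CA) (V CB) (V CC) = stage V n"
proof (induction n arbitrary: V)
  case 0
  have "range V = {V CA, V CB, V CC}"
    by (auto simp: UNIV_corner)
  then show ?case
    by (simp add: stage_0)
next
  case (Suc n)
  have "stage V (Suc n) = stage (sub_triangle CA V) n \<union> stage (sub_triangle CB V) n \<union>
      stage (sub_triangle CC V) n"
    by (auto simp: stage_Suc UNIV_corner)
  then show ?case
    by (simp add: sub_triangle_def midpoint_sym flip: Suc.IH)
qed

lemma sierpinski_triangle_eq_gasket:
  "sierpinski_triangle A B C = gasket (case_corner A B C)"
  using sierpinski_stage_eq[of _ "case_corner A B C"]
  by (simp add: sierpinski_triangle_def gasket_def)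

lemma hull_sub_triangle: "convex hull (range (sub_triangle i V)) \<subseteq> convex hull (range V)"
proof -
  have "midpoint (V i) (V j) \<in> convex hull (range V)" for j
    using convexD_alt[OF convex_convex_hull[of "range V"], of "V i" "V j" "1/2"]
    by (simp add: hull_inc midpoint_def scaleR_add_right)
  then show ?thesis
    by (intro hull_minimal) (auto simp: sub_triangle_def)
qed

lemma hull_triangle_at_append:
  "convex hull (range (triangle_at V (u @ v))) \<subseteq> convex hull (range (triangle_at V v))"
proof (induction u)
  case (Cons i u)
  then show ?case
    using hull_sub_triangle[of i "triangle_at V (u @ v)"] by auto
qed simp

lemma stage_antimono: "m \<le> n \<Longrightarrow> stage V n \<subseteq> stage V m"
proof (induction n rule: dec_induct)
  case (step n)
  have "stage V (Suc n) \<subseteq> stage V n"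
    using hull_sub_triangle unfolding stage_def words_Suc by fastforce
  then show ?case
    using step by auto
qed simp

lemma gasket_sub_triangle: "gasket (sub_triangle i V) \<subseteq> gasket V"
proof
  fix x assume x: "x \<in> gasket (sub_triangle i V)"
  have "x \<in> stage V n" for n
  proof -
    have "x \<in> stage V (Suc n)"
      using x by (auto simp: gasket_def stage_Suc)
    then show ?thesis
      using stage_antimono[of n "Suc n" V] by auto
  qed
  then show "x \<in> gasket V"
    by (simp add: gasket_def)
qed

lemma gasket_triangle_at: "gasket (triangle_at V w) \<subseteq> gasket V"
  by (induction w) (use gasket_sub_triangle in fastforce)+

lemma segment_subset_stage:
  fixes V :: "corner \<Rightarrow> 'a::euclidean_space"
  shows "closed_segment (V j) (V k) \<subseteq> stage V n"
proof (induction n arbitrary: V j k)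
  case 0
  show ?case
    unfolding stage_0 segment_convex_hull by (intro hull_mono) auto
next
  case (Suc n)
  have "closed_segment (V j) (midpoint (V j) (V k)) \<subseteq> stage V (Suc n)" for j k
    using Suc[of "sub_triangle j V" j k] by (auto simp: stage_Suc sub_triangle_def)
  from this[of j k] this[of k j] show ?case
    using Un_closed_segment[of "midpoint (V j) (V k)" "V j" "V k"]
    by (simp add: closed_segment_commute midpoint_sym) blast
qed

lemma segment_subset_gasket:
  fixes V :: "corner \<Rightarrow> 'a::euclidean_space"
  shows "closed_segment (V j) (V k) \<subseteq> gasket V"
  unfolding gasket_def using segment_subset_stage by blast

lemma vertex_in_gasket:
  fixes V :: "corner \<Rightarrow> 'a::euclidean_space"
  shows "triangle_at V w j \<in> gasket V"
proof -
  have "triangle_at V w j \<in> gasket (triangle_at V w)"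
    using segment_subset_gasket[of "triangle_at V w" j j] by auto
  then show ?thesis
    using gasket_triangle_at by blast
qed

lemma compact_gasket:
  fixes V :: "corner \<Rightarrow> 'a::euclidean_space"
  shows "compact (gasket V)"
proof -
  have c: "compact (stage V n)" for n
    unfolding stage_def by (intro compact_UN finite_words ballI finite_imp_compact_convex_hull) auto
  have "gasket V = stage V 0 \<inter> (\<Inter>n. stage V n)"
    by (auto simp: gasket_def)
  then show ?thesis
    using c by (simp add: compact_Int_closed closed_INT compact_imp_closed)
qed

definition equilateral :: "real \<Rightarrow> (corner \<Rightarrow> 'a::metric_space) \<Rightarrow> bool" where
  "equilateral l V \<longleftrightarrow> (\<forall>i j. i \<noteq> j \<longrightarrow> dist (V i) (V j) = l)"

lemma equilateral_triangle_at:
  fixes V :: "corner \<Rightarrow> 'a::real_normed_vector"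
  assumes "equilateral l V"
  shows "equilateral (l / 2 ^ length w) (triangle_at V w)"
proof (induction w)
  case (Cons i w)
  have half: "dist (midpoint (triangle_at V w i) (triangle_at V w j))
      (midpoint (triangle_at V w i) (triangle_at V w k)) =
      dist (triangle_at V w j) (triangle_at V w k) / 2" for j k
  proof -
    have "midpoint (triangle_at V w i) (triangle_at V w j) -
        midpoint (triangle_at V w i) (triangle_at V w k) =
        (1/2) *\<^sub>R (triangle_at V w j - triangle_at V w k)"
      by (simp add: midpoint_def algebra_simps)
    then show ?thesis
      by (simp add: dist_norm)
  qed
  then show ?case
    using Cons by (simp add: equilateral_def sub_triangle_def half)
qed (use assms in simp)

lemma equilateral_dist_le:
  assumes "equilateral l V" "0 \<le> l"
  shows "dist (V i) (V j) \<le> l"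
  using assms by (cases "i = j") (auto simp: equilateral_def)

lemma dist_hull_vertex_le:
  fixes V :: "corner \<Rightarrow> 'a::real_normed_vector"
  assumes "equilateral l V" "0 \<le> l" "x \<in> convex hull (range V)"
  shows "dist (V j) x \<le> l"
proof -
  have "convex hull (range V) \<subseteq> cball (V j) l"
    using assms by (intro hull_minimal convex_cball) (auto simp: equilateral_dist_le)
  then show ?thesis
    using assms(3) by auto
qed

text \<open>\<open>digits k w\<close> reads the positions of the letter \<open>k\<close> in \<open>w\<close> as a binary number. Up to the
  factor \<open>2 ^ length w\<close> these are the barycentric coordinates of a triangle of the construction.\<close>

primrec digits :: "corner \<Rightarrow> corner list \<Rightarrow> int" where
  "digits k [] = 0"
| "digits k (i # w) = 2 * digits k w + (if i = k then 1 else 0)"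

lemma sum_digits: "digits CA w + digits CB w + digits CC w = 2 ^ length w - 1"
proof (induction w)
  case (Cons i w)
  then show ?case
    by (cases i) auto
qed simp

lemma digits_inj:
  "length v = length w \<Longrightarrow> (\<And>k. digits k v = digits k w) \<Longrightarrow> v = w"
proof (induction v w rule: list_induct2)
  case (Cons i v j w)
  have eq: "2 * digits k v + (if i = k then 1 else 0) = 2 * digits k w + (if j = k then 1 else 0)" for k
    using Cons.prems by simp
  have "i = j"
    using eq[of i] by (cases "i = j") presburger+
  moreover have "digits k v = digits k w" for k
    using eq[of k] \<open>i = j\<close> by simp
  ultimately show ?case
    using Cons.IH by simp
qed simp

lemma triangle_at_digits:
  fixes V :: "corner \<Rightarrow> 'a::real_vector"
  shows "2 ^ length w *\<^sub>R triangle_at V w j =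
    of_int (digits CA w) *\<^sub>R V CA + of_int (digits CB w) *\<^sub>R V CB + of_int (digits CC w) *\<^sub>R V CC + V j"
proof (induction w arbitrary: j)
  case (Cons i w)
  have "2 ^ length (i # w) *\<^sub>R triangle_at V (i # w) j =
      2 ^ length w *\<^sub>R triangle_at V w i + 2 ^ length w *\<^sub>R triangle_at V w j"
    by (simp add: sub_triangle_def midpoint_def scaleR_add_right)
  then show ?case
    unfolding Cons by (cases i) (simp_all add: algebra_simps flip: scaleR_2)
qed simp

lemma norm_sum_zero_coeffs:
  fixes V :: "corner \<Rightarrow> 'a::real_inner"
  assumes "equilateral l V" "a + b + c = 0"
  shows "2 * (norm (a *\<^sub>R V CA + b *\<^sub>R V CB + c *\<^sub>R V CC))\<^sup>2 = l\<^sup>2 * (a\<^sup>2 + b\<^sup>2 + c\<^sup>2)"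
proof -
  define u v where "u = V CB - V CA" and "v = V CC - V CA"
  have "norm u = l" "norm v = l" "norm (u - v) = l"
    using assms(1) by (auto simp: u_def v_def equilateral_def simp flip: dist_norm)
  then have "u \<bullet> u = l\<^sup>2" "v \<bullet> v = l\<^sup>2" "(u - v) \<bullet> (u - v) = l\<^sup>2"
    by (auto simp flip: power2_norm_eq_inner)
  then have uv: "u \<bullet> u = l\<^sup>2" "v \<bullet> v = l\<^sup>2" "2 * (u \<bullet> v) = l\<^sup>2"
    by (auto simp: inner_diff inner_commute)
  have a: "a = - b - c"
    using assms(2) by simp
  have "a *\<^sub>R V CA + b *\<^sub>R V CB + c *\<^sub>R V CC = b *\<^sub>R u + c *\<^sub>R v"
    by (simp add: a u_def v_def algebra_simps)
  then have "2 * (norm (a *\<^sub>R V CA + b *\<^sub>R V CB + c *\<^sub>R V CC))\<^sup>2 =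
      2 * ((b *\<^sub>R u + c *\<^sub>R v) \<bullet> (b *\<^sub>R u + c *\<^sub>R v))"
    by (simp only: power2_norm_eq_inner)
  also have "\<dots> = 2 * b\<^sup>2 * (u \<bullet> u) + 2 * c\<^sup>2 * (v \<bullet> v) + 2 * b * c * (2 * (u \<bullet> v))"
    by (simp add: inner_add inner_commute power2_eq_square algebra_simps)
  also have "\<dots> = l\<^sup>2 * (a\<^sup>2 + b\<^sup>2 + c\<^sup>2)"
    unfolding uv a by (simp add: power2_eq_square algebra_simps)
  finally show ?thesis .
qed

lemma digits_diff_le:
  fixes V :: "corner \<Rightarrow> 'a::real_inner"
  assumes "equilateral l V" "0 < l" "v \<in> words n" "w \<in> words n"
    and "dist (triangle_at V v j) (triangle_at V w j) \<le> R * l / 2 ^ n"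
  shows "\<bar>digits k v - digits k w\<bar> \<le> \<lceil>2 * R\<rceil>"
proof -
  define \<delta> where "\<delta> i = real_of_int (digits i v - digits i w)" for i
  have len: "length v = n" "length w = n"
    using assms by (auto simp: words_def)
  have "real_of_int (digits CA v + digits CB v + digits CC v) =
      real_of_int (digits CA w + digits CB w + digits CC w)"
    unfolding sum_digits len ..
  then have sum0: "\<delta> CA + \<delta> CB + \<delta> CC = 0"
    by (simp add: \<delta>_def)
  have R: "0 \<le> R"
  proof -
    have "0 \<le> R * l / 2 ^ n * 2 ^ n"
      using order_trans[OF zero_le_dist assms(5)] by (intro mult_nonneg_nonneg) auto
    then show ?thesis
      using assms(2) by (simp add: zero_le_mult_iff)
  qed
  have "2 ^ n *\<^sub>R (triangle_at V v j - triangle_at V w j) =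
      \<delta> CA *\<^sub>R V CA + \<delta> CB *\<^sub>R V CB + \<delta> CC *\<^sub>R V CC"
    using triangle_at_digits[of v V j] triangle_at_digits[of w V j] len
    by (simp add: \<delta>_def algebra_simps)
  then have "norm (\<delta> CA *\<^sub>R V CA + \<delta> CB *\<^sub>R V CB + \<delta> CC *\<^sub>R V CC) =
      2 ^ n * dist (triangle_at V v j) (triangle_at V w j)"
    by (simp add: dist_norm flip: \<open>2 ^ n *\<^sub>R _ = _\<close>)
  also have "\<dots> \<le> R * l"
    using assms(5) by (simp add: field_simps)
  finally have "(norm (\<delta> CA *\<^sub>R V CA + \<delta> CB *\<^sub>R V CB + \<delta> CC *\<^sub>R V CC))\<^sup>2 \<le> (R * l)\<^sup>2"
    by (intro power_mono) auto
  then have "l\<^sup>2 * ((\<delta> CA)\<^sup>2 + (\<delta> CB)\<^sup>2 + (\<delta> CC)\<^sup>2) \<le> l\<^sup>2 * (2 * R\<^sup>2)"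
    using norm_sum_zero_coeffs[OF assms(1) sum0] by (simp add: power_mult_distrib algebra_simps)
  then have "(\<delta> CA)\<^sup>2 + (\<delta> CB)\<^sup>2 + (\<delta> CC)\<^sup>2 \<le> 2 * R\<^sup>2"
    using assms(2) by (simp add: mult_le_cancel_left_pos)
  moreover have "(\<delta> k)\<^sup>2 \<le> (\<delta> CA)\<^sup>2 + (\<delta> CB)\<^sup>2 + (\<delta> CC)\<^sup>2"
    by (cases k) auto
  ultimately have "(\<delta> k)\<^sup>2 \<le> 2 * R\<^sup>2"
    by linarith
  also have "\<dots> \<le> (2 * R)\<^sup>2"
    by (simp add: power_mult_distrib)
  finally have "(\<delta> k)\<^sup>2 \<le> (2 * R)\<^sup>2" .
  then have "\<bar>\<delta> k\<bar> \<le> 2 * R"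
    using R abs_le_square_iff[of "\<delta> k" "2 * R"] by simp
  then show ?thesis
    unfolding \<delta>_def by linarith
qed

text \<open>The coordinates \<open>digits\<close> of the triangles in question lie in a cube of bounded size.\<close>

lemma card_triangles_meeting_ball:
  fixes V :: "corner \<Rightarrow> 'a::real_inner"
  assumes V: "equilateral l V" and l: "0 < l"
  obtains K :: nat where
    "\<And>n x. card {w \<in> words n. convex hull (range (triangle_at V w)) \<inter> ball x (1 / 2 ^ n) \<noteq> {}} \<le> K"
proof
  define m where "m = \<lceil>2 * ((2 + 2 * l) / l)\<rceil>"
  define K where "K = card ({-m..m} \<times> {-m..m} \<times> {-m..m})"
  fix n and x :: 'a
  let ?S = "{w \<in> words n. convex hull (range (triangle_at V w)) \<inter> ball x (1 / 2 ^ n) \<noteq> {}}"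
  show "card ?S \<le> K"
  proof (cases "?S = {}")
    case False
    then obtain w where w: "w \<in> ?S" by blast
    have near: "dist (triangle_at V v CA) x \<le> (l + 1) / 2 ^ n" if v: "v \<in> ?S" for v
    proof -
      obtain y where y: "y \<in> convex hull (range (triangle_at V v))" "dist x y < 1 / 2 ^ n"
        using v by auto
      have "dist (triangle_at V v CA) y \<le> l / 2 ^ length v"
        using l by (intro dist_hull_vertex_le[OF equilateral_triangle_at[OF V] _ y(1)]) simp
      then have "dist (triangle_at V v CA) y \<le> l / 2 ^ n"
        using v by (simp add: words_def)
      then show ?thesis
        using y(2) dist_triangle[of "triangle_at V v CA" x y]
        by (simp add: add_divide_distrib dist_commute)
    qed
    have diff: "\<bar>digits k v - digits k w\<bar> \<le> m" if v: "v \<in> ?S" for v k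
    proof -
      have "dist (triangle_at V v CA) (triangle_at V w CA) \<le> (l + 1) / 2 ^ n + (l + 1) / 2 ^ n"
        using near[OF v] near[OF w]
          dist_triangle2[of "triangle_at V v CA" "triangle_at V w CA" x] by linarith
      also have "\<dots> = (2 + 2 * l) / l * l / 2 ^ n"
        using l by (simp add: field_simps)
      finally show ?thesis
        unfolding m_def using v w by (intro digits_diff_le[OF V l]) auto
    qed
    let ?c = "\<lambda>v. (digits CA v - digits CA w, digits CB v - digits CB w, digits CC v - digits CC w)"
    have "inj_on ?c ?S"
    proof (rule inj_onI)
      fix u v assume u: "u \<in> ?S" "v \<in> ?S" "?c u = ?c v"
      then have "digits k u = digits k v" for k
        by (cases k) auto
      then show "u = v"
        using u by (intro digits_inj) (auto simp: words_def)
    qed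
    moreover have "?c ` ?S \<subseteq> {-m..m} \<times> {-m..m} \<times> {-m..m}"
    proof (rule image_subsetI)
      fix v assume v: "v \<in> ?S"
      show "?c v \<in> {-m..m} \<times> {-m..m} \<times> {-m..m}"
        using diff[OF v, of CA] diff[OF v, of CB] diff[OF v, of CC] by auto
    qed
    ultimately show ?thesis
      unfolding K_def by (intro card_inj_on_le) auto
  qed (simp only: card.empty)
qed

section \<open>Mass distribution on level sets\<close>

text \<open>Corners with value exactly \<open>r\<close> count as lying above \<open>r\<close>; so no exceptional levels arise at
  the values of \<open>f\<close> at vertices.\<close>

definition below :: "(corner \<Rightarrow> 'a::real_vector) \<Rightarrow> ('a \<Rightarrow> real) \<Rightarrow> real \<Rightarrow> corner list \<Rightarrow> corner \<Rightarrow> bool"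
  where "below V f r w j \<longleftrightarrow> f (triangle_at V w j) < r"

lemma sign_tree_below: "sign_tree (below V f r)"
  by standard (simp_all add: below_def sub_triangle_def midpoint_sym)

abbreviation active :: "(corner \<Rightarrow> 'a::real_vector) \<Rightarrow> ('a \<Rightarrow> real) \<Rightarrow> real \<Rightarrow> corner list \<Rightarrow> bool"
  where "active V f r \<equiv> sign_tree.active (below V f r)"

abbreviation branchings :: "(corner \<Rightarrow> 'a::real_vector) \<Rightarrow> ('a \<Rightarrow> real) \<Rightarrow> real \<Rightarrow> corner list \<Rightarrow> nat"
  where "branchings V f r \<equiv> sign_tree.branchings (below V f r)"

lemma level_point_in_active_triangle:
  fixes V :: "corner \<Rightarrow> 'a::euclidean_space"
  assumes "continuous_on (gasket V) f" "active V f r w"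
  obtains p where "p \<in> gasket V" "f p = r" "p \<in> convex hull (range (triangle_at V w))"
proof -
  interpret sign_tree "below V f r"
    by (rule sign_tree_below)
  obtain j k where jk: "f (triangle_at V w j) < r" "r \<le> f (triangle_at V w k)"
    using active_imp_mixed[OF assms(2)] by (auto simp: mixed_def below_def not_less)
  let ?S = "closed_segment (triangle_at V w j) (triangle_at V w k)"
  have S: "?S \<subseteq> gasket V"
    using segment_subset_gasket gasket_triangle_at by blast
  have "connected (f ` ?S)"
    using S assms(1) by (intro connected_continuous_image) (auto intro: continuous_on_subset)
  then have "r \<in> f ` ?S"
    using jk connectedD_interval[of "f ` ?S" "f (triangle_at V w j)" "f (triangle_at V w k)" r]
    by auto
  moreover have "?S \<subseteq> convex hull (range (triangle_at V w))"
    unfolding segment_convex_hull by (intro hull_mono) auto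
  ultimately show ?thesis
    using S that by blast
qed

lemma dyadic_above:
  fixes y :: real
  assumes "0 < y" "y < 1 / 2 ^ N"
  obtains n where "N \<le> n" "y < 1 / 2 ^ n" "1 / 2 ^ n \<le> 2 * y"
proof -
  obtain m where "(1/2) ^ m < y"
    using real_arch_pow_inv[of y "1/2"] assms by auto
  then have ex: "\<exists>m. 1 / 2 ^ m \<le> y"
    by (auto simp: power_divide intro: less_imp_le)
  define m where "m = (LEAST m. 1 / 2 ^ m \<le> y)"
  have m: "1 / 2 ^ m \<le> y"
    unfolding m_def using ex by (rule LeastI_ex)
  have "N < m"
  proof (rule ccontr)
    assume "\<not> N < m"
    then have "(1::real) / 2 ^ N \<le> 1 / 2 ^ m"
      by (intro divide_left_mono power_increasing) auto
    then show False
      using m assms by linarith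
  qed
  then obtain n where n: "m = Suc n" "N \<le> n"
    by (cases m) auto
  have "y < 1 / 2 ^ n"
    using not_less_Least[of n "\<lambda>m. 1 / 2 ^ m \<le> y"] n by (simp add: m_def)
  moreover have "1 / 2 ^ n \<le> 2 * y"
    using m n by simp
  ultimately show ?thesis
    using that n by blast
qed

lemma hausdorff_measure_zero_cover:
  fixes A :: "'a::metric_space set"
  assumes "hausdorff_measure t A = 0" "0 < \<delta>" "0 < e" "t \<le> s" "0 < s" "\<delta> \<le> 1"
  obtains U :: "nat \<Rightarrow> 'a set" where "A \<subseteq> (\<Union>i. U i)"
    "\<And>i. bounded (U i)" "\<And>i. diameter (U i) \<le> \<delta>"
    "\<forall>I. finite I \<longrightarrow> (\<forall>i\<in>I. U i \<noteq> {}) \<longrightarrow> (\<Sum>i\<in>I. diameter (U i) powr s) \<le> e"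
proof -
  have "hausdorff_premeasure \<delta> t A \<le> hausdorff_measure t A"
    unfolding hausdorff_measure_def using assms(2) by (intro SUP_upper) auto
  also have "\<dots> < ennreal e"
    using assms by simp
  finally have "\<exists>U\<in>{U. A \<subseteq> (\<Union>i. U i) \<and> (\<forall>i. bounded (U i) \<and> diameter (U i) \<le> \<delta>)}.
      (\<Sum>i. hausdorff_weight t (U i)) < ennreal e"
    unfolding hausdorff_premeasure_def INF_less_iff .
  then obtain U :: "nat \<Rightarrow> 'a set" where U: "A \<subseteq> (\<Union>i. U i)"
      "\<And>i. bounded (U i) \<and> diameter (U i) \<le> \<delta>" "(\<Sum>i. hausdorff_weight t (U i)) < ennreal e"
    by auto
  have weight: "ennreal (diameter (U i) powr s) \<le> hausdorff_weight t (U i)" if "U i \<noteq> {}" for i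
  proof -
    have "0 \<le> diameter (U i)" "diameter (U i) \<le> 1"
      using U(2)[of i] diameter_ge_0[of "U i"] assms(6) by auto
    then have "diameter (U i) powr s \<le> diameter (U i) powr t" "diameter (U i) powr s \<le> 1"
      using assms(4,5) powr_mono'[of t s "diameter (U i)"] powr_le1[of s "diameter (U i)"] by auto
    then show ?thesis
      using that by (auto simp: hausdorff_weight_def intro: ennreal_leI)
  qed
  have "(\<Sum>i\<in>I. diameter (U i) powr s) \<le> e" if I: "finite I" "\<And>i. i \<in> I \<Longrightarrow> U i \<noteq> {}" for I
  proof -
    have "ennreal (\<Sum>i\<in>I. diameter (U i) powr s) = (\<Sum>i\<in>I. ennreal (diameter (U i) powr s))"
      by simp
    also have "\<dots> \<le> (\<Sum>i\<in>I. hausdorff_weight t (U i))"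
      using weight I(2) by (intro sum_mono) auto
    also have "\<dots> \<le> (\<Sum>i. hausdorff_weight t (U i))"
      using I(1) by (intro sum_le_suminf) auto
    finally have "ennreal (\<Sum>i\<in>I. diameter (U i) powr s) \<le> ennreal e"
      using U(3) by (meson le_less_trans less_imp_le)
    then show ?thesis
      using assms(3) by (simp add: ennreal_le_iff)
  qed
  then show ?thesis
    by (intro that[of U]) (use U in auto)
qed

lemma hausdorff_measure_level_set_nonzero:
  fixes V :: "corner \<Rightarrow> 'a::euclidean_space" and s t :: real
  assumes V: "equilateral l V" "0 < l" and f: "continuous_on (gasket V) f"
    and root: "active V f r []"
    and growth: "\<And>w. N \<le> length w \<Longrightarrow> active V f r w \<Longrightarrow> s * length w \<le> branchings V f r w"
    and s: "t \<le> s" "0 < s"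
  shows "hausdorff_measure t {x \<in> gasket V. f x = r} \<noteq> 0"
proof
  let ?L = "{x \<in> gasket V. f x = r}"
  assume zero: "hausdorff_measure t ?L = 0"
  interpret sign_tree "below V f r"
    by (rule sign_tree_below)
  obtain K :: nat where K:
    "\<And>n x. card {w \<in> words n. convex hull (range (triangle_at V w)) \<inter> ball x (1 / 2 ^ n) \<noteq> {}} \<le> K"
    by (rule card_triangles_meeting_ball[OF V]) (rule that, simp)
  define e where "e = min (1 / (2 powr s * (3 * K + 1))) ((1 / 2 ^ Suc N) powr s)"
  have "0 < 2 powr s * (3 * real K + 1)"
    by (intro mult_pos_pos) auto
  then have e: "0 < e" "e * (2 powr s * (3 * K + 1)) \<le> 1" "e \<le> (1 / 2 ^ Suc N) powr s"
    by (auto simp: e_def pos_le_divide_eq[symmetric])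
  have \<delta>: "0 < (1::real) / 2 ^ Suc N" "(1::real) / 2 ^ Suc N \<le> 1"
    using one_le_power[of "2::real" "Suc N"] by (auto simp: divide_le_eq)
  obtain U :: "nat \<Rightarrow> 'a set" where U: "?L \<subseteq> (\<Union>i. U i)" "\<And>i. bounded (U i)"
    "\<And>i. diameter (U i) \<le> 1 / 2 ^ Suc N"
    "\<forall>I. finite I \<longrightarrow> (\<forall>i\<in>I. U i \<noteq> {}) \<longrightarrow> (\<Sum>i\<in>I. diameter (U i) powr s) \<le> e"
    by (rule hausdorff_measure_zero_cover[OF zero \<delta>(1) e(1) s \<delta>(2)]) (rule that; simp)
  define y where "y i = max (diameter (U i)) ((e / 2 ^ i) powr (1 / s))" for i :: nat
  have "\<exists>n. N \<le> n \<and> y i < 1 / 2 ^ n \<and> 1 / 2 ^ n \<le> 2 * y i" for i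
  proof -
    have "0 < y i"
      using e by (simp add: y_def less_max_iff_disj)
    have "(e / 2 ^ i) powr (1 / s) \<le> e powr (1 / s)"
      using e s by (intro powr_mono2) (auto simp: divide_le_eq)
    also have "\<dots> \<le> ((1 / 2 ^ Suc N) powr s) powr (1 / s)"
      using e s by (intro powr_mono2) auto
    also have "\<dots> = 1 / 2 ^ Suc N"
      using s by (simp add: powr_powr)
    finally have "y i \<le> 1 / 2 ^ Suc N"
      using U(3)[of i] by (simp add: y_def)
    also have "\<dots> < 1 / 2 ^ N"
      by (simp add: field_simps)
    finally show ?thesis
      using dyadic_above[OF \<open>0 < y i\<close>, of N] by metis
  qed
  then obtain n where n: "\<And>i. N \<le> n i" "\<And>i. y i < 1 / 2 ^ n i" "\<And>i. 1 / 2 ^ n i \<le> 2 * y i"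
    by metis
  have small: "(1 / 2 ^ n i) powr s \<le> 2 powr s * (diameter (U i) powr s + e * (1/2) ^ i)" for i
  proof -
    have d: "0 \<le> diameter (U i)"
      using U(2) by (rule diameter_ge_0)
    have "(1 / 2 ^ n i) powr s \<le> (2 * y i) powr s"
      using n(3)[of i] s by (intro powr_mono2) auto
    also have "\<dots> = 2 powr s * y i powr s"
      using d by (intro powr_mult)
    also have "y i powr s \<le> diameter (U i) powr s + ((e / 2 ^ i) powr (1 / s)) powr s"
      by (auto simp: y_def max_def)
    also have "((e / 2 ^ i) powr (1 / s)) powr s = e * (1/2) ^ i"
      using e s by (simp add: powr_powr power_divide)
    finally show ?thesis
      by simp
  qed
  define c where "c i = (SOME x. x \<in> U i)" for i
  define B where "B i = ball (c i) (1 / 2 ^ n i)" for i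
  have UB: "U i \<subseteq> B i" if "U i \<noteq> {}" for i
  proof
    fix x assume x: "x \<in> U i"
    have "c i \<in> U i"
      using that unfolding c_def by (rule some_in_eq[THEN iffD2])
    then have "dist (c i) x \<le> diameter (U i)"
      using U(2) x by (intro diameter_bounded_bound)
    also have "\<dots> \<le> y i"
      by (simp add: y_def)
    finally show "x \<in> B i"
      using n(2)[of i] by (simp add: B_def)
  qed
  have "?L = gasket V \<inter> (gasket V \<inter> f -` {r})"
    by auto
  also have "compact \<dots>"
    using compact_gasket[of V] f
    by (intro compact_Int_closed continuous_closed_preimage) (auto intro: compact_imp_closed)
  finally have "compact ?L" .
  moreover have "open (B i)" if "i \<in> {i. U i \<noteq> {}}" for i
    by (simp add: B_def)
  moreover have "?L \<subseteq> (\<Union>i\<in>{i. U i \<noteq> {}}. B i)"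
    using U(1) UB by blast
  ultimately obtain J where J: "J \<subseteq> {i. U i \<noteq> {}}" "finite J" "?L \<subseteq> (\<Union>i\<in>J. B i)"
    by (rule compactE_image)
  define M where "M = (\<Sum>i\<in>J. n i)"
  have M: "n i \<le> M" if "i \<in> J" for i
    unfolding M_def using that J(2) by (intro member_le_sum) auto
  define S where "S i = {w \<in> words (n i). active w \<and> convex hull (range (triangle_at V w)) \<inter> B i \<noteq> {}}" for i
  have fin: "finite (S i)" for i
    unfolding S_def by (intro finite_subset[OF _ finite_words[of "n i"]]) auto
  have "1 \<le> (\<Sum>v\<in>(\<Union>i\<in>J. S i). mass v)"
  proof (rule sum_mass_cut_ge[OF root])
    show "finite (\<Union>i\<in>J. S i)"
      using fin J(2) by blast
    show "active v \<and> length v \<le> M" if "v \<in> (\<Union>i\<in>J. S i)" for v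
      using that M by (auto simp: S_def words_def)
    show "\<exists>v\<in>(\<Union>i\<in>J. S i). \<exists>u. w = u @ v" if w: "w \<in> words M" "active w" for w
    proof -
      obtain p where p: "p \<in> gasket V" "f p = r" "p \<in> convex hull (range (triangle_at V w))"
        using level_point_in_active_triangle[OF f w(2)] .
      then obtain i where i: "i \<in> J" "p \<in> B i"
        using J(3) by auto
      let ?v = "drop (M - n i) w"
      have eq: "w = take (M - n i) w @ ?v"
        by simp
      have "active ?v"
        using w(2) active_append[of "take (M - n i) w" ?v] by simp
      moreover have "p \<in> convex hull (range (triangle_at V ?v))"
        using p(3) hull_triangle_at_append[of V "take (M - n i) w" ?v] by auto
      moreover have "?v \<in> words (n i)"
        using w(1) M[OF i(1)] by (simp add: words_def)
      ultimately have "?v \<in> S i"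
        using i(2) by (auto simp: S_def)
      then show ?thesis
        using eq i(1) by blast
    qed
  qed
  also have "\<dots> \<le> (\<Sum>(i, v)\<in>Sigma J S. mass v)"
    using fin J(2) mass_nonneg
    by (intro sum_le_included[where i = snd]) (auto intro!: finite_SigmaI)
  also have "\<dots> = (\<Sum>i\<in>J. \<Sum>v\<in>S i. mass v)"
    using fin J(2) by (subst sum.Sigma) auto
  also have "\<dots> \<le> (\<Sum>i\<in>J. K * (2 powr s * (diameter (U i) powr s + e * (1/2) ^ i)))"
  proof (intro sum_mono)
    fix i assume "i \<in> J"
    have "mass v \<le> (1 / 2 ^ n i) powr s" if v: "v \<in> S i" for v
    proof -
      have v: "active v" "length v = n i"
        using v by (auto simp: S_def words_def)
      have "mass v \<le> (1/2) ^ branchings v"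
        using v by (intro mass_le)
      also have "\<dots> = (1/2) powr branchings v"
        by (simp add: powr_realpow)
      also have "\<dots> \<le> (1/2) powr (s * n i)"
        using growth[of v] v n(1)[of i] by (intro powr_mono') auto
      also have "\<dots> = (1 / 2 ^ n i) powr s"
        using powr_powr[of "1/2" "n i" s] by (simp add: powr_realpow power_divide mult.commute)
      finally show ?thesis .
    qed
    then have "(\<Sum>v\<in>S i. mass v) \<le> card (S i) * (1 / 2 ^ n i) powr s"
      using sum_bounded_above[of "S i" mass "(1 / 2 ^ n i) powr s"] by simp
    also have "\<dots> \<le> K * (1 / 2 ^ n i) powr s"
    proof (intro mult_right_mono)
      have "card (S i) \<le> card {w \<in> words (n i). convex hull (range (triangle_at V w)) \<inter> B i \<noteq> {}}"
        by (intro card_mono finite_subset[OF _ finite_words[of "n i"]]) (auto simp: S_def)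
      then show "real (card (S i)) \<le> real K"
        using K[of "n i" "c i"] by (simp add: B_def)
    qed simp
    also have "\<dots> \<le> K * (2 powr s * (diameter (U i) powr s + e * (1/2) ^ i))"
      using small by (intro mult_left_mono) auto
    finally show "(\<Sum>v\<in>S i. mass v) \<le> K * (2 powr s * (diameter (U i) powr s + e * (1/2) ^ i))" .
  qed
  also have "\<dots> = K * 2 powr s * ((\<Sum>i\<in>J. diameter (U i) powr s) + e * (\<Sum>i\<in>J. (1/2) ^ i))"
    by (simp add: sum.distrib sum_distrib_left algebra_simps)
  also have "\<dots> \<le> K * 2 powr s * (e + e * 2)"
  proof (intro mult_left_mono add_mono)
    show "(\<Sum>i\<in>J. diameter (U i) powr s) \<le> e"
      using J U(4) by blast
    have "(\<Sum>i\<in>J. (1/2) ^ i) \<le> (\<Sum>i. (1/2::real) ^ i)"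
      using J(2) by (intro sum_le_suminf) auto
    then show "(\<Sum>i\<in>J. (1/2::real) ^ i) \<le> 2"
      by (simp add: suminf_geometric)
  qed (use e in auto)
  also have "\<dots> < 1"
    using e(1,2) by (simp add: algebra_simps)
      (smt (verit, best) powr_gt_zero mult_pos_pos)
  finally show False
    by simp
qed

section \<open>Almost every level\<close>

instance corner :: countable
  by countable_datatype

lemma powr_scale:
  fixes l \<alpha> :: real
  assumes "0 < l"
  shows "(l / 2 ^ n) powr \<alpha> = l powr \<alpha> * (1 / 2 powr \<alpha>) ^ n"
proof -
  have "(2 ^ n) powr \<alpha> = (2 powr \<alpha>) ^ n"
    by (simp add: powr_powr powr_power mult.commute flip: powr_realpow)
  then show ?thesis
    using assms by (simp add: powr_divide power_divide)
qed

lemma powr_scale_tendsto_0: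
  fixes l \<alpha> :: real
  assumes "0 < l" "0 < \<alpha>"
  shows "(\<lambda>n. (l / 2 ^ n) powr \<alpha>) \<longlonglongrightarrow> 0"
proof -
  have "(\<lambda>n. l powr \<alpha> * (1 / 2 powr \<alpha>) ^ n) \<longlonglongrightarrow> l powr \<alpha> * 0"
    using assms by (intro tendsto_mult_left LIMSEQ_realpow_zero) auto
  then show ?thesis
    using assms by (simp add: powr_scale)
qed

lemma continuous_on_holder1:
  assumes "holder1_on \<alpha> F f" "0 < \<alpha>"
  shows "continuous_on F f"
  unfolding continuous_on_iff
proof (intro ballI allI impI)
  fix x and e :: real assume x: "x \<in> F" "0 < e"
  show "\<exists>d>0. \<forall>y\<in>F. dist y x < d \<longrightarrow> dist (f y) (f x) < e"
  proof (intro exI[of _ "e powr (1 / \<alpha>)"] conjI ballI impI)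
    fix y assume y: "y \<in> F" "dist y x < e powr (1 / \<alpha>)"
    have "dist (f y) (f x) \<le> dist y x powr \<alpha>"
      using assms(1) x y by (simp add: holder1_on_def dist_real_def)
    also have "\<dots> < (e powr (1 / \<alpha>)) powr \<alpha>"
      using y assms(2) by (intro powr_less_mono2) auto
    also have "\<dots> = e"
      using assms(2) x by (simp add: powr_powr)
    finally show "dist (f y) (f x) < e" .
  qed (use x in simp)
qed

lemma holder1_on_subset: "holder1_on \<alpha> F f \<Longrightarrow> G \<subseteq> F \<Longrightarrow> holder1_on \<alpha> G f"
  by (auto simp: holder1_on_def)

lemma holder1_on_triangle_le:
  fixes V :: "corner \<Rightarrow> 'a::euclidean_space"
  assumes V: "equilateral l V" "0 < l" and f: "holder1_on \<alpha> (gasket V) f" "0 < \<alpha>"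
    and w: "w \<in> words n" and p: "p \<in> gasket V" "p \<in> convex hull (range (triangle_at V w))"
  shows "\<bar>f (triangle_at V w j) - f p\<bar> \<le> (l / 2 ^ n) powr \<alpha>"
proof -
  have "dist (triangle_at V w j) p \<le> l / 2 ^ length w"
    using V(2) by (intro dist_hull_vertex_le[OF equilateral_triangle_at[OF V(1)] _ p(2)]) simp
  then have "dist (triangle_at V w j) p powr \<alpha> \<le> (l / 2 ^ n) powr \<alpha>"
    using w f(2) by (intro powr_mono2) (auto simp: words_def)
  moreover have "\<bar>f (triangle_at V w j) - f p\<bar> \<le> dist (triangle_at V w j) p powr \<alpha>"
    using f(1) vertex_in_gasket[of V w j] p(1) by (simp add: holder1_on_def)
  ultimately show ?thesis
    by linarith
qed

lemma AE_branchings_ge: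
  fixes V :: "corner \<Rightarrow> 'a::euclidean_space" and s :: real
  assumes V: "equilateral l V" "0 < l" and f: "holder1_on \<alpha> (gasket V) f" "0 < \<alpha>"
    and \<rho>: "\<rho>\<^sup>2 = \<rho> + 6 * x" "1 \<le> \<rho>" and x: "0 < x" "x \<le> 1"
    and rate: "\<rho> * x powr (- s) / 2 powr \<alpha> < 1"
  shows "AE r in lborel. \<exists>N. \<forall>w. N \<le> length w \<longrightarrow> active V f r w \<longrightarrow>
    s * length w \<le> branchings V f r w"
proof -
  define q where "q = \<rho> * x powr (- s) / 2 powr \<alpha>"
  define I where "I w = cball (f (triangle_at V w CA)) ((l / 2 ^ length w) powr \<alpha>)" for w
  define W where "W n = {w \<in> words n. doubles w < s * n}" for n
  define C where "C n = (\<Union>w\<in>W n. I w)" for n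
  have fin: "finite (W n)" for n
    by (simp add: W_def)
  have meas: "C n \<in> sets lborel" for n
    unfolding C_def I_def using fin by (intro sets.finite_UN) auto
  have "measure lborel (C n) \<le> 6 * l powr \<alpha> * q ^ n" for n
  proof -
    have "measure lborel (C n) \<le> (\<Sum>w\<in>W n. measure lborel (I w))"
      unfolding C_def by (intro measure_UNION_le fin) (simp add: I_def)
    also have "\<dots> = (\<Sum>w\<in>W n. 2 * (l / 2 ^ n) powr \<alpha>)"
      by (intro sum.cong refl) (auto simp: I_def W_def words_def cball_eq_atLeastAtMost)
    also have "\<dots> = card (W n) * (2 * (l / 2 ^ n) powr \<alpha>)"
      by simp
    also have "\<dots> \<le> 3 * \<rho> ^ n * x powr (- (s * n)) * (2 * (l / 2 ^ n) powr \<alpha>)"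
      unfolding W_def by (intro mult_right_mono card_few_doubles_le \<rho> x) auto
    also have "x powr (- (s * n)) = (x powr (- s)) ^ n"
      using x by (simp add: powr_power mult.commute)
    also have "3 * \<rho> ^ n * (x powr (- s)) ^ n * (2 * (l / 2 ^ n) powr \<alpha>) = 6 * l powr \<alpha> * q ^ n"
      unfolding powr_scale[OF V(2)] q_def by (simp add: power_divide power_mult_distrib)
    finally show ?thesis .
  qed
  then have bound: "norm (measure lborel (C n)) \<le> 6 * l powr \<alpha> * q ^ n" for n
    by simp
  have "\<bar>q\<bar> < 1"
    using rate \<rho> by (simp add: q_def)
  then have "summable (\<lambda>n. 6 * l powr \<alpha> * q ^ n)"
    by (intro summable_mult summable_geometric) simp
  then have "summable (\<lambda>n. measure lborel (C n))"
    using bound by (rule summable_comparison_test')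
  moreover have "emeasure lborel (C n) < \<infinity>" for n
    unfolding C_def I_def using fin
    by (intro emeasure_bounded_finite bounded_UN) auto
  ultimately have "AE r in lborel. eventually (\<lambda>n. r \<in> space lborel - C n) sequentially"
    by (intro borel_cantelli_AE1 meas)
  then show ?thesis
  proof eventually_elim
    case (elim r)
    interpret sign_tree "below V f r"
      by (rule sign_tree_below)
    obtain N where N: "\<And>n. N \<le> n \<Longrightarrow> r \<notin> C n"
      using elim by (auto simp: eventually_sequentially)
    have "s * length w \<le> branchings w" if w: "N \<le> length w" "active w" for w
    proof -
      have len: "w \<in> words (length w)"
        by (simp add: words_def)
      obtain j k where jk: "f (triangle_at V w j) < r" "r \<le> f (triangle_at V w k)"
        using active_imp_mixed[OF w(2)] by (auto simp: mixed_def below_def not_less)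
      have "\<bar>f (triangle_at V w CA) - f (triangle_at V w i)\<bar> \<le> (l / 2 ^ length w) powr \<alpha>" for i
        by (intro holder1_on_triangle_le[OF V f len] vertex_in_gasket hull_inc) auto
      from this[of j] this[of k] jk have "r \<in> I w"
        by (auto simp: I_def dist_real_def)
      then have "w \<notin> W (length w)"
        using N[OF w(1)] by (auto simp: C_def)
      then have "s * length w \<le> doubles w"
        using len by (simp add: W_def not_less)
      then show ?thesis
        using doubles_le_branchings[OF w(2)] by linarith
    qed
    then show ?case
      by blast
  qed
qed

lemma hausdorff_measure_zero_mono:
  assumes "A \<subseteq> B" "hausdorff_measure s B = 0"
  shows "hausdorff_measure s A = 0"
proof -
  have "hausdorff_premeasure \<delta> s A \<le> hausdorff_premeasure \<delta> s B" for \<delta>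
    unfolding hausdorff_premeasure_def using assms(1) by (intro INF_superset_mono) auto
  then have "hausdorff_measure s A \<le> hausdorff_measure s B"
    unfolding hausdorff_measure_def by (intro SUP_mono) auto
  then show ?thesis
    using assms(2) by simp
qed

lemma hausdorff_dim_mono: "A \<subseteq> B \<Longrightarrow> hausdorff_dim A \<le> hausdorff_dim B"
  unfolding hausdorff_dim_def
  by (intro Inf_superset_mono) (auto intro: hausdorff_measure_zero_mono)

lemma hausdorff_dim_geI:
  assumes "\<And>t. 0 \<le> t \<Longrightarrow> t < s \<Longrightarrow> hausdorff_measure t A \<noteq> 0"
  shows "ereal s \<le> hausdorff_dim A"
  unfolding hausdorff_dim_def using assms by (intro Inf_greatest) (force simp: not_less)

text \<open>Since \<open>x < 1\<close>, every exponent below the critical \<open>s\<close> has rate less than one in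
  \<open>AE_branchings_ge\<close>; countably many such exponents suffice.\<close>

lemma AE_root_active_imp_dim_ge:
  fixes V :: "corner \<Rightarrow> 'a::euclidean_space" and s :: real
  assumes V: "equilateral l V" "0 < l" and f: "holder1_on \<alpha> (gasket V) f" "0 < \<alpha>"
    and \<rho>: "\<rho>\<^sup>2 = \<rho> + 6 * x" "1 \<le> \<rho>" and x: "0 < x" "x < 1" and s: "0 < s"
    and rate: "\<rho> * x powr (- s) \<le> 2 powr \<alpha>"
  shows "AE r in lborel. active V f r [] \<longrightarrow> ereal s \<le> hausdorff_dim {y \<in> gasket V. f y = r}"
proof -
  define \<sigma> where "\<sigma> k = s * (1 - 1 / (real k + 2))" for k
  have \<sigma>: "0 < \<sigma> k" "\<sigma> k < s" for k
  proof -
    have "0 < 1 / (real k + 2)" "1 / (real k + 2) < 1"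
      by auto
    then have "0 < s * (1 - 1 / (real k + 2))" "s * (1 - 1 / (real k + 2)) < s * 1"
      using s by (intro mult_pos_pos mult_strict_left_mono; simp)+
    then show "0 < \<sigma> k" "\<sigma> k < s"
      by (simp_all add: \<sigma>_def)
  qed
  have lim: "\<sigma> \<longlonglongrightarrow> s"
    unfolding \<sigma>_def by real_asymp
  have "AE r in lborel. \<exists>N. \<forall>w. N \<le> length w \<longrightarrow> active V f r w \<longrightarrow>
      \<sigma> k * length w \<le> branchings V f r w" for k
  proof (rule AE_branchings_ge[OF V f \<rho> x(1)])
    have "x powr (- \<sigma> k) < x powr (- s)"
      using x \<sigma>(2)[of k] by (intro powr_less_mono') auto
    then have "\<rho> * x powr (- \<sigma> k) < \<rho> * x powr (- s)"
      using \<rho>(2) by simp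
    then show "\<rho> * x powr (- \<sigma> k) / 2 powr \<alpha> < 1"
      using rate by simp
  qed (use x in simp)
  then have "AE r in lborel. \<forall>k. \<exists>N. \<forall>w. N \<le> length w \<longrightarrow> active V f r w \<longrightarrow>
      \<sigma> k * length w \<le> branchings V f r w"
    by (simp add: AE_all_countable)
  then show ?thesis
  proof eventually_elim
    case (elim r)
    show ?case
    proof (intro impI hausdorff_dim_geI)
      fix t assume root: "active V f r []" and t: "0 \<le> t" "t < s"
      obtain k where "t < \<sigma> k"
        using order_tendstoD(1)[OF lim t(2)] by (auto simp: eventually_sequentially)
      moreover obtain N where "\<And>w. N \<le> length w \<Longrightarrow> active V f r w \<Longrightarrow>
          \<sigma> k * length w \<le> branchings V f r w"
        using elim by blast
      ultimately show "hausdorff_measure t {y \<in> gasket V. f y = r} \<noteq> 0"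
        using \<sigma>(1)
        by (intro hausdorff_measure_level_set_nonzero[OF V continuous_on_holder1[OF f] root, of N "\<sigma> k"]) auto
    qed
  qed
qed

lemma same_signs_everywhere:
  assumes "\<And>w. \<not> mixed (below V f r w)"
  shows "below V f r w j = below V f r [] CA"
proof -
  interpret sign_tree "below V f r"
    by (rule sign_tree_below)
  have const: "below V f r w i = below V f r w j" for w i j
    using assms[of w] unfolding mixed_def by blast
  have "below V f r w CA = below V f r [] CA"
  proof (induction w)
    case (Cons i w)
    then show ?case
      using const[of "i # w" CA i] const[of w i CA] same_corner[of i w] by simp
  qed simp
  then show ?thesis
    using const by blast
qed

lemma level_extremal_or_crossed:
  fixes V :: "corner \<Rightarrow> 'a::euclidean_space"
  assumes V: "equilateral l V" "0 < l" and f: "holder1_on \<alpha> (gasket V) f" "0 < \<alpha>"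
    and r: "r \<in> f ` gasket V" "\<And>w. \<not> mixed (below V f r w)"
  shows "r = Sup (f ` gasket V) \<or> r = Inf (f ` gasket V)"
proof -
  have approx: "\<exists>w j. \<bar>f (triangle_at V w j) - f p\<bar> \<le> (l / 2 ^ n) powr \<alpha>" if p: "p \<in> gasket V" for p n
  proof -
    obtain w where "w \<in> words n" "p \<in> convex hull (range (triangle_at V w))"
      using p by (auto simp: gasket_def stage_def)
    then show ?thesis
      using holder1_on_triangle_le[OF V f _ p] by blast
  qed
  show ?thesis
  proof (cases "below V f r [] CA")
    case True
    then have vert: "f (triangle_at V w j) < r" for w j
      using same_signs_everywhere[OF r(2)] by (simp add: below_def)
    have "f p \<le> r" if p: "p \<in> gasket V" for p
    proof -
      have "f p - r \<le> (l / 2 ^ n) powr \<alpha>" for n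
      proof -
        obtain w j where "\<bar>f (triangle_at V w j) - f p\<bar> \<le> (l / 2 ^ n) powr \<alpha>"
          using approx[OF p] by blast
        then show ?thesis
          using vert[of w j] by linarith
      qed
      then show ?thesis
        using LIMSEQ_le_const[OF powr_scale_tendsto_0[OF V(2) f(2)], of "f p - r"] by auto
    qed
    then have "Sup (f ` gasket V) = r"
      using r(1) by (intro cSup_eq_maximum) auto
    then show ?thesis by simp
  next
    case False
    then have vert: "r \<le> f (triangle_at V w j)" for w j
      using same_signs_everywhere[OF r(2)] by (simp add: below_def not_less)
    have "r \<le> f p" if p: "p \<in> gasket V" for p
    proof -
      have "r - f p \<le> (l / 2 ^ n) powr \<alpha>" for n
      proof -
        obtain w j where "\<bar>f (triangle_at V w j) - f p\<bar> \<le> (l / 2 ^ n) powr \<alpha>"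
          using approx[OF p] by blast
        then show ?thesis
          using vert[of w j] by linarith
      qed
      then show ?thesis
        using LIMSEQ_le_const[OF powr_scale_tendsto_0[OF V(2) f(2)], of "r - f p"] by auto
    qed
    then have "Inf (f ` gasket V) = r"
      using r(1) by (intro cInf_eq_minimum) auto
    then show ?thesis by simp
  qed
qed

lemma AE_level_set_dim_ge:
  fixes V :: "corner \<Rightarrow> 'a::euclidean_space" and s :: real
  assumes V: "equilateral l V" "0 < l" and f: "holder1_on \<alpha> (gasket V) f" "0 < \<alpha>"
    and \<rho>: "\<rho>\<^sup>2 = \<rho> + 6 * x" "1 \<le> \<rho>" and x: "0 < x" "x < 1" and s: "0 < s"
    and rate: "\<rho> * x powr (- s) \<le> 2 powr \<alpha>"
  shows "AE r in lborel. r \<in> f ` gasket V \<longrightarrow> ereal s \<le> hausdorff_dim {y \<in> gasket V. f y = r}"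
proof -
  have "AE r in lborel. active (triangle_at V w) f r [] \<longrightarrow>
      ereal s \<le> hausdorff_dim {y \<in> gasket (triangle_at V w). f y = r}" for w
    using V(2) f(1) gasket_triangle_at[of V w]
    by (intro AE_root_active_imp_dim_ge[OF equilateral_triangle_at[OF V(1)] _ _ f(2) \<rho> x s rate])
      (auto intro: holder1_on_subset)
  then have "AE r in lborel. \<forall>w. active (triangle_at V w) f r [] \<longrightarrow>
      ereal s \<le> hausdorff_dim {y \<in> gasket (triangle_at V w). f y = r}"
    by (simp add: AE_all_countable)
  moreover have "AE r in lborel. r \<noteq> Sup (f ` gasket V)" "AE r in lborel. r \<noteq> Inf (f ` gasket V)"
    by (rule AE_lborel_singleton)+
  ultimately show ?thesis
  proof eventually_elim
    case (elim r)
    show ?case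
    proof
      assume "r \<in> f ` gasket V"
      then obtain w where "mixed (below V f r w)"
        using level_extremal_or_crossed[OF V f] elim(2,3) by blast
      then have "mixed (below (triangle_at V w) f r [])"
        by (simp add: mixed_def below_def)
      then have "active (triangle_at V w) f r []"
        by (simp add: sign_tree.active.simps[OF sign_tree_below])
      then have "ereal s \<le> hausdorff_dim {y \<in> gasket (triangle_at V w). f y = r}"
        using elim(1) by blast
      also have "\<dots> \<le> hausdorff_dim {y \<in> gasket V. f y = r}"
        using gasket_triangle_at[of V w] by (intro hausdorff_dim_mono) auto
      finally show "ereal s \<le> hausdorff_dim {y \<in> gasket V. f y = r}" .
    qed
  qed
qed

section \<open>The function \<open>h\<close>\<close>

lemma h_fun_has_derivative:
  assumes "0 < d" "d < 1"
  shows "(h_fun has_real_derivative (ln 6 - ln d + 2 * ln (1 - d)) / ((1 + d)\<^sup>2 * ln 2)) (at d)"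
proof -
  have "((\<lambda>d. (- d * ln d - (1 - d) * ln (1 - d) + d * ln 6) / ((1 + d) * ln 2)) has_real_derivative
      (ln 6 - ln d + 2 * ln (1 - d)) / ((1 + d)\<^sup>2 * ln 2)) (at d)"
    using assms
    by (auto intro!: derivative_eq_intros simp: divide_simps)
      (simp add: power2_eq_square algebra_simps)
  then show ?thesis
    by (simp add: h_fun_def[abs_def])
qed

lemma less_6_mult_square:
  fixes d :: real
  assumes "0 < d" "d \<le> 1/2"
  shows "d < 6 * (1 - d)\<^sup>2"
proof -
  have "(1/2)\<^sup>2 \<le> (1 - d)\<^sup>2"
    using assms by (intro power_mono) auto
  then show ?thesis
    using assms by (simp add: power2_eq_square)
qed

lemma h_fun_strict_mono: "strict_mono_on {0<..1/2} h_fun"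
proof (rule strict_mono_onI)
  fix c d :: real assume cd: "c \<in> {0<..1/2}" "d \<in> {0<..1/2}" "c < d"
  show "h_fun c < h_fun d"
  proof (rule DERIV_pos_imp_increasing[OF \<open>c < d\<close>])
    fix y assume y: "c \<le> y" "y \<le> d"
    then have y01: "0 < y" "y \<le> 1/2"
      using cd by auto
    have "ln y < ln (6 * (1 - y)\<^sup>2)"
      using less_6_mult_square[OF y01] y01 by simp
    also have "\<dots> = ln 6 + 2 * ln (1 - y)"
      using y01 by (simp add: ln_mult ln_realpow)
    finally have "0 < (ln 6 - ln y + 2 * ln (1 - y)) / ((1 + y)\<^sup>2 * ln 2)"
      using y01 by (intro divide_pos_pos mult_pos_pos) auto
    then show "\<exists>z. (h_fun has_real_derivative z) (at y) \<and> 0 < z"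
      using h_fun_has_derivative[of y] y01 by auto
  qed
qed

lemma h_fun_half_ge: "1 \<le> h_fun (1/2)"
proof -
  have "2 * ln 2 = ln ((2::real)\<^sup>2)"
    using ln_realpow[of "2::real" 2] by simp
  also have "\<dots> \<le> ln 6"
    by (subst ln_le_cancel_iff) auto
  finally have "2 * ln 2 \<le> ln (6::real)" .
  moreover have "0 < ln (2::real)"
    by simp
  ultimately show ?thesis
    by (simp add: h_fun_def ln_div field_simps)
qed

lemma h_inv_works:
  assumes "0 < \<alpha>" "\<alpha> \<le> 1"
  shows "0 < h_inv \<alpha>" "h_inv \<alpha> \<le> 1/2" "h_fun (h_inv \<alpha>) = \<alpha>"
proof -
  have "(h_fun \<longlongrightarrow> 0) (at_right 0)"
    unfolding h_fun_def by real_asymp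
  then have "eventually (\<lambda>d. h_fun d < \<alpha>) (at_right 0)"
    using assms(1) by (rule order_tendstoD)
  moreover have "eventually (\<lambda>d::real. d \<in> {0<..<1/2}) (at_right 0)"
    by (rule eventually_at_right_real) simp
  ultimately have "eventually (\<lambda>d. h_fun d < \<alpha> \<and> d < 1/2 \<and> 0 < d) (at_right 0)"
    by eventually_elim auto
  then obtain c where c: "h_fun c < \<alpha>" "c < 1/2" "0 < c"
    using eventually_happens[of _ "at_right (0::real)"] by auto
  have "continuous_on {c..1/2} h_fun"
    using c by (intro continuous_at_imp_continuous_on ballI DERIV_isCont[OF h_fun_has_derivative]) auto
  then obtain d where d: "c \<le> d" "d \<le> 1/2" "h_fun d = \<alpha>"
    using IVT'[of h_fun c \<alpha> "1/2"] c h_fun_half_ge assms(2) by auto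
  have "h_inv \<alpha> = d"
    unfolding h_inv_def using d c
    by (intro the_inv_into_f_eq strict_mono_on_imp_inj_on[OF h_fun_strict_mono]) auto
  then show "0 < h_inv \<alpha>" "h_inv \<alpha> \<le> 1/2" "h_fun (h_inv \<alpha>) = \<alpha>"
    using c d by auto
qed

text \<open>The optimal weight \<open>x\<close> of a block of length two: with \<open>\<rho> = 1 / (1 - d)\<close> a proportion \<open>d\<close> of
  the blocks has length two, that is, \<open>1 / \<rho> = 1 - d\<close> and \<open>6 * x / \<rho>\<^sup>2 = d\<close>.\<close>

lemma optimal_weight:
  fixes d :: real
  assumes d: "0 < d" "d \<le> 1/2"
  defines "\<rho> \<equiv> 1 / (1 - d)" and "x \<equiv> d / (6 * (1 - d)\<^sup>2)"
  shows "\<rho>\<^sup>2 = \<rho> + 6 * x" "1 \<le> \<rho>" "0 < x" "x < 1"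
    and "\<rho> * x powr (- (d / (1 + d))) = 2 powr h_fun d"
proof -
  have pos: "0 < 1 - d"
    using d by simp
  show "\<rho>\<^sup>2 = \<rho> + 6 * x"
    using pos by (simp add: \<rho>_def x_def divide_simps) (simp add: power2_eq_square algebra_simps)
  show "1 \<le> \<rho>" "0 < x" "x < 1"
    using d pos less_6_mult_square[OF d] by (auto simp: \<rho>_def x_def)
  have lnx: "ln x = ln d - ln 6 - 2 * ln (1 - d)"
    using d pos by (simp add: x_def ln_div ln_mult ln_realpow)
  have "ln (\<rho> * x powr (- (d / (1 + d)))) = - ln (1 - d) - d / (1 + d) * ln x"
    using pos \<open>0 < x\<close> by (simp add: ln_mult ln_powr ln_div \<rho>_def)
  also have "\<dots> = h_fun d * ln 2"
    using d unfolding lnx h_fun_def by (simp add: divide_simps) (simp add: algebra_simps)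
  also have "\<dots> = ln (2 powr h_fun d)"
    by (simp add: ln_powr)
  finally show "\<rho> * x powr (- (d / (1 + d))) = 2 powr h_fun d"
    using pos \<open>0 < x\<close> by (subst (asm) ln_inj_iff) (auto simp: \<rho>_def)
qed

section \<open>Generic functions\<close>

lemma holder1_space_subset_funspace:
  assumes "compact F" "0 \<le> \<alpha>"
  shows "holder1_space \<alpha> F \<subseteq> mspace (funspace F euclidean_metric)"
  using topspace_holder1_topology[OF assms] by (auto simp: holder1_topology_def)

lemma openin_separating:
  assumes "compact F" "0 \<le> \<alpha>" and ab: "a \<in> F" "b \<in> F"
  shows "openin (holder1_topology \<alpha> F) {f \<in> holder1_space \<alpha> F. f a \<noteq> f b}"
proof -
  let ?m = "funspace F (euclidean_metric :: real metric)"
  interpret M: Metric_space "mspace ?m" "mdist ?m"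
    by (rule Metric_space_mspace_mdist)
  let ?U = "{f \<in> mspace ?m. f a \<noteq> f b}"
  have "\<exists>r>0. M.mball f r \<subseteq> ?U" if f: "f \<in> ?U" for f
  proof (intro exI[of _ "\<bar>f a - f b\<bar> / 2"] conjI subsetI)
    fix g assume g: "g \<in> M.mball f (\<bar>f a - f b\<bar> / 2)"
    then have gm: "g \<in> mspace ?m" "mdist ?m f g < \<bar>f a - f b\<bar> / 2"
      unfolding M.in_mball by auto
    have "\<bar>f x - g x\<bar> \<le> mdist ?m f g" if "x \<in> F" for x
      using funspace_mdist_le[of f F euclidean_metric g "mdist ?m f g"] f gm(1) that
      by (auto simp: dist_real_def)
    from this[OF ab(1)] this[OF ab(2)] show "g \<in> ?U"
      using gm f by auto
  qed (use f in auto)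
  then have "openin M.mtopology ?U"
    unfolding M.openin_mtopology by blast
  moreover have "{f \<in> holder1_space \<alpha> F. f a \<noteq> f b} = ?U \<inter> holder1_space \<alpha> F"
    using holder1_space_subset_funspace[OF assms(1,2)] by auto
  ultimately show ?thesis
    unfolding holder1_topology_def openin_subtopology mtopology_of_def by blast
qed

lemma holder1_on_convex_combination:
  fixes F :: "'a::metric_space set"
  assumes f: "holder1_on \<alpha> F f" and t: "0 \<le> t" "t \<le> 1" and \<alpha>: "0 \<le> \<alpha>" "\<alpha> \<le> 1"
    and diam: "\<And>u v. u \<in> F \<Longrightarrow> v \<in> F \<Longrightarrow> dist u v \<le> 1"
  shows "holder1_on \<alpha> F (\<lambda>u. (1 - t) * f u + t * dist u b)"
  unfolding holder1_on_def
proof (intro ballI)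
  fix u v assume uv: "u \<in> F" "v \<in> F"
  have "\<bar>((1 - t) * f u + t * dist u b) - ((1 - t) * f v + t * dist v b)\<bar> =
      \<bar>(1 - t) * (f u - f v) + t * (dist u b - dist v b)\<bar>"
    by (simp add: algebra_simps)
  also have "\<dots> \<le> (1 - t) * \<bar>f u - f v\<bar> + t * \<bar>dist u b - dist v b\<bar>"
    using t by (intro order_trans[OF abs_triangle_ineq]) (simp add: abs_mult)
  also have "\<dots> \<le> (1 - t) * dist u v powr \<alpha> + t * dist u v powr \<alpha>"
  proof (intro add_mono mult_left_mono)
    show "\<bar>f u - f v\<bar> \<le> dist u v powr \<alpha>"
      using f uv by (simp add: holder1_on_def)
    have "\<bar>dist u b - dist v b\<bar> \<le> dist u v"
      using dist_triangle[of u b v] dist_triangle[of v b u] by (simp add: dist_commute abs_le_iff)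
    also have "\<dots> \<le> dist u v powr \<alpha>"
      using powr_mono'[of \<alpha> 1 "dist u v"] \<alpha> diam[OF uv] by simp
    finally show "\<bar>dist u b - dist v b\<bar> \<le> dist u v powr \<alpha>" .
  qed (use t in auto)
  also have "\<dots> = dist u v powr \<alpha>"
    by (simp add: algebra_simps)
  finally show "\<bar>((1 - t) * f u + t * dist u b) - ((1 - t) * f v + t * dist v b)\<bar> \<le> dist u v powr \<alpha>" .
qed

lemma dense_separating:
  fixes F :: "'a::metric_space set"
  assumes F: "compact F" "\<And>u v. u \<in> F \<Longrightarrow> v \<in> F \<Longrightarrow> dist u v \<le> 1"
    and \<alpha>: "0 < \<alpha>" "\<alpha> \<le> 1" and ab: "a \<in> F" "b \<in> F" "a \<noteq> b"
  shows "holder1_topology \<alpha> F closure_of {f \<in> holder1_space \<alpha> F. f a \<noteq> f b} =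
    topspace (holder1_topology \<alpha> F)"
proof -
  let ?m = "funspace F (euclidean_metric :: real metric)" and ?H = "holder1_space \<alpha> F"
  let ?G = "{f \<in> ?H. f a \<noteq> f b}"
  interpret M: Metric_space "mspace ?m" "mdist ?m"
    by (rule Metric_space_mspace_mdist)
  have sub: "?H \<subseteq> mspace ?m"
    using \<alpha> by (intro holder1_space_subset_funspace F(1)) simp
  have "\<exists>g\<in>?G. g \<in> M.mball f e" if f: "f \<in> ?H" and e: "0 < e" for f e
  proof (cases "f a = f b")
    case False
    moreover have "f \<in> M.mball f e"
      using f e sub by (simp only: M.centre_in_mball_iff) blast
    ultimately show ?thesis
      using f by blast
  next
    case True
    have hol: "holder1_on \<alpha> F f"
      using f by (simp add: holder1_space_def)
    have "bounded (f ` F)"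
      by (intro compact_imp_bounded compact_continuous_image continuous_on_holder1[OF hol \<alpha>(1)] F(1))
    then obtain B where B: "\<And>u. u \<in> F \<Longrightarrow> \<bar>f u\<bar> \<le> B"
      by (auto simp: bounded_iff)
    then have B0: "0 \<le> B"
      using ab(1) abs_ge_zero order_trans by blast
    define t where "t = min 1 (e / (2 * (B + 1)))"
    have t: "0 < t" "t \<le> 1" "t * (2 * (B + 1)) \<le> e"
      using e B0 by (simp_all add: t_def flip: pos_le_divide_eq)
    define g where "g = restrict (\<lambda>u. (1 - t) * f u + t * dist u b) F"
    have "holder1_on \<alpha> F g"
      using holder1_on_convex_combination[OF hol _ t(2) _ \<alpha>(2) F(2), of b] t \<alpha>
      by (simp add: holder1_on_def g_def)
    then have g: "g \<in> ?H"
      by (simp add: holder1_space_def g_def)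
    have "g a - g b = t * dist a b"
      using ab True by (simp add: g_def)
    then have sep: "g a \<noteq> g b"
      using t(1) ab(3) by auto
    have "mdist ?m f g \<le> e / 2"
    proof (subst funspace_mdist_le)
      show "\<forall>u\<in>F. mdist euclidean_metric (f u) (g u) \<le> e / 2"
      proof
        fix u assume u: "u \<in> F"
        have "\<bar>f u - g u\<bar> = \<bar>t * (f u - dist u b)\<bar>"
          using u by (simp add: g_def algebra_simps)
        also have "\<dots> = t * \<bar>f u - dist u b\<bar>"
          using t(1) by (simp add: abs_mult)
        also have "\<bar>f u - dist u b\<bar> \<le> B + 1"
          using B[OF u] F(2)[OF u ab(2)] zero_le_dist[of u b] by linarith
        finally have "\<bar>f u - g u\<bar> \<le> t * (B + 1)"
          using t(1) by simp
        then show "mdist euclidean_metric (f u) (g u) \<le> e / 2"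
          using t(3) by (simp add: dist_real_def algebra_simps)
      qed
    qed (use f g sub ab in auto)
    then have "g \<in> M.mball f e"
      unfolding M.in_mball using f g sub e by auto
    then show ?thesis
      using g sep by blast
  qed
  then have "?H \<subseteq> M.mtopology closure_of ?G"
    unfolding M.metric_closure_of using sub by blast
  moreover have "?H \<inter> ?G = ?G"
    by auto
  ultimately have "holder1_topology \<alpha> F closure_of ?G = ?H"
    unfolding holder1_topology_def closure_of_subtopology mtopology_of_def by auto
  then show ?thesis
    using topspace_holder1_topology[OF F(1)] \<alpha> by simp
qed

lemma hausdorff_dim_empty: "hausdorff_dim ({} :: 'a::metric_space set) = 0"
proof -
  have "hausdorff_premeasure \<delta> s ({} :: 'a set) = 0" if "0 < \<delta>" for \<delta> s
  proof -
    have "hausdorff_premeasure \<delta> s ({} :: 'a set) \<le> (\<Sum>i::nat. hausdorff_weight s ({} :: 'a set))"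
      unfolding hausdorff_premeasure_def using that by (intro INF_lower) (auto simp: diameter_def)
    then show ?thesis
      by (simp add: hausdorff_weight_def)
  qed
  then have zero: "hausdorff_measure s ({} :: 'a set) = 0" for s
    by (simp add: hausdorff_measure_def)
  show ?thesis
    unfolding hausdorff_dim_def zero
    by (intro antisym Inf_lower Inf_greatest) (auto intro!: exI[of _ 0] simp: zero_ereal_def)
qed

text \<open>Measurability of the set in the definition of \<^const>\<open>level_dim\<close> is part of the claim here:
  \<^const>\<open>emeasure\<close> is zero on sets that are not measurable.\<close>

lemma level_dim_ge:
  fixes F :: "'a::metric_space set"
  assumes s: "0 < s" and F: "f ` F \<in> sets lebesgue" "emeasure lebesgue (f ` F) > 0"
    and AE: "AE r in lebesgue. r \<in> f ` F \<longrightarrow> ereal s \<le> hausdorff_dim {x \<in> F. f x = r}"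
  shows "ereal s \<le> level_dim F f"
proof -
  let ?S = "{r. ereal s \<le> hausdorff_dim {x \<in> F. f x = r}}"
  have sub: "?S \<subseteq> f ` F"
  proof
    fix r assume r: "r \<in> ?S"
    show "r \<in> f ` F"
    proof (rule ccontr)
      assume "r \<notin> f ` F"
      then have "{x \<in> F. f x = r} = {}"
        by auto
      then show False
        using r s by (simp only: mem_Collect_eq hausdorff_dim_empty) (simp add: zero_ereal_def)
    qed
  qed
  obtain N where "N \<in> null_sets lebesgue" "f ` F - ?S \<subseteq> N"
    using AE by (auto simp: eventually_ae_filter)
  then have null: "f ` F - ?S \<in> null_sets lebesgue"
    by (metis null_sets_completion_subset)
  have S: "?S = f ` F - (f ` F - ?S)"
    using sub by auto
  have "emeasure lebesgue ?S = emeasure lebesgue (f ` F)"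
    by (subst S) (rule emeasure_Diff_null_set[OF null F(1)])
  then show ?thesis
    unfolding level_dim_def using F(2) by (intro Sup_upper) auto
qed

theorem theorem3p4:
  fixes A B C :: "real ^ 2" and \<alpha> :: real
  assumes "dist A B = 1" and "dist B C = 1" and "dist C A = 1"
    and "0 < \<alpha>" and "\<alpha> \<le> 1"
  shows "(\<forall>f. holder1_on \<alpha> (sierpinski_triangle A B C) f \<longrightarrow>
            (AE r in lebesgue. r \<in> f ` sierpinski_triangle A B C \<longrightarrow>
               hausdorff_dim {x \<in> sierpinski_triangle A B C. f x = r}
                 \<ge> ereal (h_inv \<alpha> / (1 + h_inv \<alpha>))))
       \<and> generic_level_dim \<alpha> (sierpinski_triangle A B C)
           \<ge> ereal (h_inv \<alpha> / (1 + h_inv \<alpha>))"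
proof
  define V where "V = case_corner A B C"
  define F where "F = gasket V"
  define d where "d = h_inv \<alpha>"
  define s where "s = d / (1 + d)"
  have tri: "sierpinski_triangle A B C = F"
    by (simp add: F_def V_def sierpinski_triangle_eq_gasket)
  have V: "equilateral 1 V"
    unfolding equilateral_def
  proof (intro allI impI)
    fix i j :: corner assume "i \<noteq> j"
    then show "dist (V i) (V j) = 1"
      using assms(1-3) by (cases i; cases j) (simp_all add: V_def dist_commute)
  qed
  have d: "0 < d" "d \<le> 1/2" "h_fun d = \<alpha>"
    unfolding d_def using h_inv_works[OF assms(4,5)] by auto
  then have s: "0 < s"
    by (simp add: s_def)
  have AE: "AE r in lebesgue. r \<in> f ` F \<longrightarrow> ereal s \<le> hausdorff_dim {x \<in> F. f x = r}"
    if f: "holder1_on \<alpha> F f" for f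
  proof (rule AE_completion)
    note weight = optimal_weight[OF d(1,2)]
    show "AE r in lborel. r \<in> f ` F \<longrightarrow> ereal s \<le> hausdorff_dim {x \<in> F. f x = r}"
      unfolding F_def
      by (rule AE_level_set_dim_ge[OF V zero_less_one f[unfolded F_def] assms(4) weight(1-4) s])
        (simp only: s_def weight(5) d(3) order_refl)
  qed
  then show "\<forall>f. holder1_on \<alpha> (sierpinski_triangle A B C) f \<longrightarrow>
      (AE r in lebesgue. r \<in> f ` sierpinski_triangle A B C \<longrightarrow>
        hausdorff_dim {x \<in> sierpinski_triangle A B C. f x = r} \<ge> ereal (h_inv \<alpha> / (1 + h_inv \<alpha>)))"
    by (simp add: tri s_def d_def)

  have F: "compact F"
    unfolding F_def by (rule compact_gasket)
  have vert: "A \<in> F" "B \<in> F"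
    using vertex_in_gasket[of V "[]" CA] vertex_in_gasket[of V "[]" CB] by (auto simp: F_def V_def)
  have diam: "dist u v \<le> 1" if "u \<in> F" "v \<in> F" for u v
  proof -
    have hull: "F \<subseteq> convex hull (range V)"
      unfolding F_def gasket_def by (auto simp flip: stage_0)
    have "convex hull (range V) \<subseteq> cball v 1"
      using dist_hull_vertex_le[OF V _ subsetD[OF hull that(2)]]
      by (intro hull_minimal convex_cball) (auto simp: dist_commute)
    then show ?thesis
      using hull that(1) by (auto simp: dist_commute)
  qed
  define G where "G = {f \<in> holder1_space \<alpha> F. f A \<noteq> f B}"
  have "gdelta_in (holder1_topology \<alpha> F) G"
    unfolding G_def using assms(4) by (intro open_imp_gdelta_in openin_separating F vert) simp
  moreover have "holder1_topology \<alpha> F closure_of G = topspace (holder1_topology \<alpha> F)"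
    unfolding G_def using assms by (intro dense_separating F diam vert) auto
  ultimately have G: "G \<in> dense_gdeltas \<alpha> F"
    by (simp add: dense_gdeltas_def)
  have "ereal s \<le> level_dim F f" if f: "f \<in> G" for f
  proof (rule level_dim_ge[OF s])
    have hol: "holder1_on \<alpha> F f" and ne: "f A \<noteq> f B"
      using f by (auto simp: G_def holder1_space_def)
    note cont = continuous_on_holder1[OF hol assms(4)]
    show "f ` F \<in> sets lebesgue"
      using compact_continuous_image[OF cont F] by (simp add: compact_imp_closed)
    have seg: "closed_segment A B \<subseteq> F"
      using segment_subset_gasket[of V CA CB] by (simp add: F_def V_def)
    then have "connected (f ` closed_segment A B)"
      using cont by (intro connected_continuous_image) (auto intro: continuous_on_subset)
    then have "{min (f A) (f B)..max (f A) (f B)} \<subseteq> f ` closed_segment A B"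
      by (rule connected_contains_Icc) (auto simp: min_def max_def)
    also have "\<dots> \<subseteq> f ` F"
      using seg by (rule image_mono)
    finally have "{min (f A) (f B)..max (f A) (f B)} \<subseteq> f ` F" .
    then have "emeasure lebesgue {min (f A) (f B)..max (f A) (f B)} \<le> emeasure lebesgue (f ` F)"
      using \<open>f ` F \<in> sets lebesgue\<close> by (rule emeasure_mono)
    moreover have "0 < emeasure lebesgue {min (f A) (f B)..max (f A) (f B)}"
      using ne by (auto simp: min_def max_def)
    ultimately show "emeasure lebesgue (f ` F) > 0"
      by order
    show "AE r in lebesgue. r \<in> f ` F \<longrightarrow> ereal s \<le> hausdorff_dim {x \<in> F. f x = r}"
      by (rule AE[OF hol])
  qed
  then have "ereal s \<le> generic_level_dim \<alpha> F"
    unfolding generic_level_dim_def by (intro SUP_upper2[OF G] INF_greatest)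
  then show "generic_level_dim \<alpha> (sierpinski_triangle A B C) \<ge> ereal (h_inv \<alpha> / (1 + h_inv \<alpha>))"
    by (simp add: tri s_def d_def)
qed

end
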